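(* Let $X,Y$ be finite-dimensional real Euclidean spaces, $g:X\to(-\infty,+\infty]$ and $f:Y\to(-\infty,+\infty]$ proper closed convex functions, $f^*$ the convex conjugate of $f$, $K:X\to Y$ a linear operator, and assume $\mathcal{L}(x,y)=g(x)+\langle Kx,y\rangle-f^*(y)$ has at least one saddle point. Let $\{a_k\}_{k\ge1},\{b_k\}_{k\ge1}\subset(0,1)$ be monotonically non-increasing sequences, $\tau_0>0$, $\beta>0$, $\mu\in(0,1)$, $\theta>0$ an upper bound for the quantities $\theta_k$ below (e.g. $\theta=\frac{1+\sqrt5}{2}$), and $\delta\in(0,1)$ with $\delta+\theta^2a_k+a_k<1$ and $\delta+b_k<1$ for all $k$. Given $(x_0,y_1)\in X\times Y$, set $x_0^{ag}=x_0$, $y_1^{ag}=y_1$, $\theta_0=1$, and for $k=1,2,\dots$: (1) $x_k^{ag}=(1-a_k)x_{k-1}^{ag}+a_kx_{k-1}$, $y_{k+1}^{ag}=(1-b_{k+1})y_k^{ag}+b_{k+1}y_k$; (2) $x_k^{md}=(1-a_k)x_{k-1}+a_kx_k^{ag}$, $y_{k+1}^{md}=(1-b_{k+1})y_k+b_{k+1}y_{k+1}^{ag}$; (3) $x_k=\mathrm{Prox}_{\tau_{k-1}g}(x_k^{md}-\tau_{k-1}K^Ty_k)$; (4) set $\tau_k=\tau_{k-1}\sqrt{1+\theta_{k-1}}$ and perform the linesearch: compute $\theta_k=\tau_k/\tau_{k-1}$, $\bar x_k=x_k+\theta_k(x_k-x_{k-1})$, $y_{k+1}=\mathrm{Prox}_{\beta\tau_kf^*}(y_{k+1}^{md}+\beta\tau_kK\bar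 x_k)$; if $\sqrt\beta\,\tau_k\|K^Ty_{k+1}-K^Ty_k\|\le\delta\|y_{k+1}-y_k\|$ accept these values, otherwise replace $\tau_k$ by $\mu\tau_k$ and repeat the linesearch computations. Then the sequence $\{(x_k,y_k)\}$ converges to a saddle point of $\mathcal{L}$.
   Context: For a proper closed convex $h$ and $\lambda>0$, $\mathrm{Prox}_{\lambda h}(x)=\arg\min_{z}\{h(z)+\frac{1}{2\lambda}\|z-x\|^2\}$. $K^T$ is the adjoint of $K$. A saddle point $(\hat x,\hat y)$ satisfies $\mathcal{L}(\hat x,y)\le\mathcal{L}(\hat x,\hat y)\le\mathcal{L}(x,\hat y)$ for all $(x,y)$. This iteration is called NPDAL in the paper. *)

theory Defs
  imports "HOL-Analysis.Analysis" "HOL-Library.Extended_Real"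
begin

definition proper_fun :: "('a \<Rightarrow> ereal) \<Rightarrow> bool" where
  "proper_fun h \<longleftrightarrow> (\<forall>x. h x \<noteq> -\<infinity>) \<and> (\<exists>x. h x \<noteq> \<infinity>)"

definition convex_fun :: "('a::real_vector \<Rightarrow> ereal) \<Rightarrow> bool" where
  "convex_fun h \<longleftrightarrow> convex {(x, t::real). h x \<le> ereal t}"

definition closed_fun :: "('a::real_normed_vector \<Rightarrow> ereal) \<Rightarrow> bool" where
  "closed_fun h \<longleftrightarrow> closed {(x, t::real). h x \<le> ereal t}"

definition conj_fun :: "('a::real_inner \<Rightarrow> ereal) \<Rightarrow> 'a \<Rightarrow> ereal" where
  "conj_fun h y = (SUP x. ereal (x \<bullet> y) - h x)"

definition prox :: "real \<Rightarrow> ('a::real_normed_vector \<Rightarrow> ereal) \<Rightarrow> 'a \<Rightarrow> 'a" where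
  "prox lam h x = arg_min (\<lambda>z. h z + ereal ((norm (z - x))\<^sup>2 / (2 * lam))) (\<lambda>_. True)"

definition lagr :: "('a \<Rightarrow> 'b::real_inner) \<Rightarrow> ('a \<Rightarrow> ereal) \<Rightarrow> ('b \<Rightarrow> ereal) \<Rightarrow> 'a \<Rightarrow> 'b \<Rightarrow> ereal" where
  "lagr K g f x y = g x + ereal (K x \<bullet> y) - conj_fun f y"

definition saddle_point :: "('a \<Rightarrow> 'b \<Rightarrow> ereal) \<Rightarrow> 'a \<Rightarrow> 'b \<Rightarrow> bool" where
  "saddle_point L xh yh \<longleftrightarrow> (\<forall>x y. L xh y \<le> L xh yh \<and> L xh yh \<le> L x yh)"

text \<open>One iteration k (k >= 1) of NPDAL. The state before iteration k is
  (x_{k-1}, x^ag_{k-1}, y_k, y^ag_k, tau_{k-1}, theta_{k-1}); the state after is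
  (x_k, x^ag_k, y_{k+1}, y^ag_{k+1}, tau_k, theta_k).
  The linesearch tries tau = mu^i * tau_{k-1} * sqrt(1 + theta_{k-1}) for i = 0,1,2,...
  and accepts the first i satisfying the test.\<close>
definition npdal_step ::
  "('a::euclidean_space \<Rightarrow> 'b::euclidean_space) \<Rightarrow> ('a \<Rightarrow> ereal) \<Rightarrow> ('b \<Rightarrow> ereal)
   \<Rightarrow> (nat \<Rightarrow> real) \<Rightarrow> (nat \<Rightarrow> real) \<Rightarrow> real \<Rightarrow> real \<Rightarrow> real \<Rightarrow> nat
   \<Rightarrow> 'a \<times> 'a \<times> 'b \<times> 'b \<times> real \<times> real \<Rightarrow> 'a \<times> 'a \<times> 'b \<times> 'b \<times> real \<times> real" where
  "npdal_step K g f a b \<beta> \<mu> \<delta> k st =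
    (case st of (xp, xagp, yk, yagk, taup, thetap) \<Rightarrow>
     let xag = (1 - a k) *\<^sub>R xagp + a k *\<^sub>R xp;
         yag' = (1 - b (Suc k)) *\<^sub>R yagk + b (Suc k) *\<^sub>R yk;
         xmd = (1 - a k) *\<^sub>R xp + a k *\<^sub>R xag;
         ymd = (1 - b (Suc k)) *\<^sub>R yk + b (Suc k) *\<^sub>R yag';
         xk = prox taup g (xmd - taup *\<^sub>R adjoint K yk);
         tr = taup * sqrt (1 + thetap);
         xbar = (\<lambda>t. xk + (t / taup) *\<^sub>R (xk - xp));
         ynew = (\<lambda>t. prox (\<beta> * t) (conj_fun f) (ymd + (\<beta> * t) *\<^sub>R K (xbar t)));
         accept = (\<lambda>t. sqrt \<beta> * t * norm (adjoint K (ynew t) - adjoint K yk)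
                         \<le> \<delta> * norm (ynew t - yk));
         i = (LEAST i::nat. accept (\<mu> ^ i * tr));
         tk = \<mu> ^ i * tr
     in (xk, xag, ynew tk, yag', tk, tk / taup))"

primrec npdal_state ::
  "('a::euclidean_space \<Rightarrow> 'b::euclidean_space) \<Rightarrow> ('a \<Rightarrow> ereal) \<Rightarrow> ('b \<Rightarrow> ereal)
   \<Rightarrow> (nat \<Rightarrow> real) \<Rightarrow> (nat \<Rightarrow> real) \<Rightarrow> real \<Rightarrow> real \<Rightarrow> real \<Rightarrow> real \<Rightarrow> 'a \<Rightarrow> 'b \<Rightarrow> nat
   \<Rightarrow> 'a \<times> 'a \<times> 'b \<times> 'b \<times> real \<times> real" where
  "npdal_state K g f a b \<beta> \<mu> \<delta> \<tau>0 x0 y1 0 = (x0, x0, y1, y1, \<tau>0, 1)"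
| "npdal_state K g f a b \<beta> \<mu> \<delta> \<tau>0 x0 y1 (Suc k) =
     npdal_step K g f a b \<beta> \<mu> \<delta> (Suc k) (npdal_state K g f a b \<beta> \<mu> \<delta> \<tau>0 x0 y1 k)"

definition npdal_x where
  "npdal_x K g f a b \<beta> \<mu> \<delta> \<tau>0 x0 y1 k = fst (npdal_state K g f a b \<beta> \<mu> \<delta> \<tau>0 x0 y1 k)"

text \<open>y_k for k >= 1 (index 0 unused; set to y_1).\<close>
definition npdal_y where
  "npdal_y K g f a b \<beta> \<mu> \<delta> \<tau>0 x0 y1 k =
     (case k of 0 \<Rightarrow> y1 | Suc j \<Rightarrow> fst (snd (snd (npdal_state K g f a b \<beta> \<mu> \<delta> \<tau>0 x0 y1 j))))"

definition npdal_theta where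
  "npdal_theta K g f a b \<beta> \<mu> \<delta> \<tau>0 x0 y1 k =
     snd (snd (snd (snd (snd (npdal_state K g f a b \<beta> \<mu> \<delta> \<tau>0 x0 y1 k)))))"

end

theory Submission
  imports Defs
begin

text \<open>The four prox inequalities give, for every saddle point, a Lyapunov function made of the squared
  distances of the iterates and of their averages, a multiple of the primal gap weighted by the step
  size, and an anchor term; it decreases up to a scalar normalisation. Its residuals vanish, so
  all cluster points are saddle points, and since saddle points form a product set, comparing two
  saddle points with the same dual part cancels the gap term: the primal iterates converge by an
  Opial argument.

  The step sizes may be unbounded, so the gap term is not obviously negligible for the dual iterates.
  If the linesearch cuts the step size infinitely often, the gap term vanishes along the cuts, where
  some dual cluster point is approached, and the Lyapunov function of that point forces convergence.
  Otherwise the step sizes grow geometrically, the linesearch criterion makes \<open>K\<^sup>T y\<^sub>k\<close> converge, and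
  the gap terms of two dual cluster points agree, so the Opial argument applies again.\<close>

section \<open>Closed convex functions and proximal points\<close>

text \<open>The growth rule \<open>sqrt (1 + Th n)\<close> is what makes the gap terms telescope. A
  step leaves the gap at the new iterate with coefficient \<open>T n * (1 + Th n)\<close>, and the
  next step consumes it with coefficient
  \<open>T (Suc n) * Th (Suc n) = T n * (Th (Suc n))\<^sup>2\<close>; the rule makes the two equal,
  and a cut leaves a surplus. The strict conditions on the averaging parameters give, by
  monotonicity, one slack \<eta> for all steps, and this slack keeps a positive multiple of every
  squared difference as residual. What obstructs the usual Opial argument is the averaging. The
  Lyapunov function controls only the sum of the distances of an iterate and of its average, and if
  the averaging parameters are summable the average may settle away from the limit of the iterates.
  So neither distance is known to converge by itself. The difference of two such sums for two
  solutions is affine, and the recursion of the average makes it possible to split off the part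
  belonging to the iterate. For two dual points this difference still contains the difference of two
  gap terms multiplied by a step size, which is why the dual part needs a case distinction.\<close>

definition edom :: "('a \<Rightarrow> ereal) \<Rightarrow> 'a set" where
  "edom h = {x. h x \<noteq> \<infinity>}"

lemma le_ereal_iff_edom:
  assumes "proper_fun h"
  shows "h x \<le> ereal t \<longleftrightarrow> x \<in> edom h \<and> real_of_ereal (h x) \<le> t"
  using assms by (cases "h x") (auto simp: proper_fun_def edom_def)

lemma ereal_real_edom:
  assumes "proper_fun h" "x \<in> edom h"
  shows "h x = ereal (real_of_ereal (h x))"
  using assms by (cases "h x") (auto simp: proper_fun_def edom_def)

lemma edom_nonempty: "proper_fun h \<Longrightarrow> \<exists>x. x \<in> edom h"
  by (auto simp: proper_fun_def edom_def)

text \<open>A point strictly below the graph, over a point of the domain, is separated from the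
  closed convex epigraph. Since the epigraph contains the graph point above it, the hyperplane
  cannot be vertical, and solving for the last coordinate gives the minorant.\<close>

lemma affine_minorant:
  fixes h :: "'a::euclidean_space \<Rightarrow> ereal"
  assumes "proper_fun h" "closed_fun h" "convex_fun h"
  obtains v c where "\<And>x. x \<in> edom h \<Longrightarrow> v \<bullet> x + c \<le> real_of_ereal (h x)"
proof -
  let ?E = "{(x, t::real). h x \<le> ereal t}"
  obtain x0 where x0: "x0 \<in> edom h" using edom_nonempty[OF assms(1)] by blast
  define r0 where "r0 = real_of_ereal (h x0)"
  have "(x0, r0 - 1) \<notin> ?E" using x0 le_ereal_iff_edom[OF assms(1)] by (auto simp: r0_def)
  then obtain w b where wb: "w \<bullet> (x0, r0 - 1) < b" "\<And>z. z \<in> ?E \<Longrightarrow> b < w \<bullet> z"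
    using separating_hyperplane_closed_point[of ?E "(x0, r0 - 1)"] assms
    unfolding closed_fun_def convex_fun_def by blast
  obtain v s where w: "w = (v, s)" by (cases w)
  have "(x0, r0) \<in> ?E" using x0 le_ereal_iff_edom[OF assms(1)] by (auto simp: r0_def)
  from wb(2)[OF this] wb(1) have s: "s > 0" by (simp add: w inner_Pair algebra_simps)
  have "(- (1/s)) *\<^sub>R v \<bullet> x + b / s \<le> real_of_ereal (h x)" if x: "x \<in> edom h" for x
  proof -
    have "(x, real_of_ereal (h x)) \<in> ?E" using x le_ereal_iff_edom[OF assms(1)] by auto
    from wb(2)[OF this] have "b < v \<bullet> x + s * real_of_ereal (h x)" by (simp add: w inner_Pair)
    then show ?thesis using s by (simp add: field_simps)
  qed
  then show ?thesis by (rule that)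
qed

lemma closed_fun_limit:
  fixes h :: "'a::euclidean_space \<Rightarrow> ereal"
  assumes "proper_fun h" "closed_fun h"
    and "\<And>n. z n \<in> edom h" "\<And>n. real_of_ereal (h (z n)) \<le> c n"
    and "z \<longlonglongrightarrow> z'" "c \<longlonglongrightarrow> c'"
  shows "z' \<in> edom h \<and> real_of_ereal (h z') \<le> c'"
proof -
  have "(z n, c n) \<in> {(x, t::real). h x \<le> ereal t}" for n
    using assms(3,4) le_ereal_iff_edom[OF assms(1)] by auto
  from closed_sequentially[OF assms(2)[unfolded closed_fun_def] this tendsto_Pair[OF assms(5,6)]]
  have "(z', c') \<in> {(x, t::real). h x \<le> ereal t}" .
  then show ?thesis using le_ereal_iff_edom[OF assms(1)] by auto
qed

lemma convex_fun_edom: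
  assumes "proper_fun h" "convex_fun h" "x \<in> edom h" "y \<in> edom h" "0 \<le> s" "s \<le> 1"
  shows "(1 - s) *\<^sub>R x + s *\<^sub>R y \<in> edom h \<and>
    real_of_ereal (h ((1 - s) *\<^sub>R x + s *\<^sub>R y))
      \<le> (1 - s) * real_of_ereal (h x) + s * real_of_ereal (h y)"
proof -
  let ?E = "{(x, t::real). h x \<le> ereal t}"
  have "(x, real_of_ereal (h x)) \<in> ?E" "(y, real_of_ereal (h y)) \<in> ?E"
    using assms le_ereal_iff_edom[OF assms(1)] by auto
  from convexD[OF assms(2)[unfolded convex_fun_def] this, of "1 - s" s] assms(5,6)
  show ?thesis using le_ereal_iff_edom[OF assms(1)] by simp
qed

text \<open>On the epigraph the objective becomes the continuous function \<open>t + ?q z\<close>,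
  so lower semicontinuity of \<open>h\<close> enters only as closedness of the epigraph. The
  sublevel set \<open>C\<close> is compact because the affine minorant is outgrown by the quadratic
  term.\<close>

lemma prox_minimizer_exists:
  fixes h :: "'a::euclidean_space \<Rightarrow> ereal"
  assumes "proper_fun h" "closed_fun h" "convex_fun h" "lam > 0"
  shows "\<exists>p\<in>edom h. \<forall>z\<in>edom h. real_of_ereal (h p) + (norm (p - x))\<^sup>2 / (2 * lam)
    \<le> real_of_ereal (h z) + (norm (z - x))\<^sup>2 / (2 * lam)"
proof -
  let ?E = "{(x, t::real). h x \<le> ereal t}"
  let ?q = "\<lambda>z. (norm (z - x))\<^sup>2 / (2 * lam)"
  obtain v c where vc: "\<And>x. x \<in> edom h \<Longrightarrow> v \<bullet> x + c \<le> real_of_ereal (h x)"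
    using affine_minorant[OF assms(1-3)] by blast
  obtain x0 where x0: "x0 \<in> edom h" using edom_nonempty[OF assms(1)] by blast
  define t0 where "t0 = real_of_ereal (h x0) + ?q x0"
  define C where "C = ?E \<inter> {w. snd w + ?q (fst w) \<le> t0}"
  have "closed {w::'a \<times> real. snd w + ?q (fst w) \<le> t0}"
    by (intro closed_Collect_le continuous_intros) (use assms(4) in auto)
  then have closed: "closed C"
    unfolding C_def using assms(2) unfolding closed_fun_def by (rule closed_Int[rotated])
  \<comment> \<open>The right-hand side after completing the square in
    \<open>norm (z - x)\<close>.\<close>
  define R where "R = 2 * lam * (t0 - v \<bullet> x - c) + (lam * norm v)\<^sup>2"
  have bnd: "norm (fst w - x) \<le> lam * norm v + sqrt \<bar>R\<bar> \<and>
      snd w \<le> t0 \<and> v \<bullet> fst w + c \<le> snd w" if w: "w \<in> C" for w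
  proof -
    obtain z t where zt: "w = (z, t)" by (cases w)
    from w have 1: "z \<in> edom h" "real_of_ereal (h z) \<le> t" "t + ?q z \<le> t0"
      using le_ereal_iff_edom[OF assms(1)] by (auto simp: C_def zt)
    have 2: "v \<bullet> z + c \<le> t" using vc[OF 1(1)] 1(2) by simp
    have 3: "t \<le> t0" using 1(3) assms(4) by (smt (verit) divide_nonneg_pos zero_le_power2)
    have 4: "- (norm v * norm (z - x)) \<le> v \<bullet> (z - x)"
      using Cauchy_Schwarz_ineq2[of v "z - x"] by linarith
    have "v \<bullet> x + c + v \<bullet> (z - x) + ?q z \<le> t0" using 2 1(3) by (simp add: inner_diff_right)
    with 4 have "?q z \<le> t0 - v \<bullet> x - c + norm v * norm (z - x)" by linarith
    then have "(norm (z - x))\<^sup>2 \<le> 2 * lam * (t0 - v \<bullet> x - c + norm v * norm (z - x))"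
      using assms(4) by (simp add: divide_le_eq mult.commute)
    then have "(norm (z - x) - lam * norm v)\<^sup>2 \<le> R"
      by (simp add: R_def power2_eq_square algebra_simps)
    then have "(norm (z - x) - lam * norm v)\<^sup>2 \<le> \<bar>R\<bar>" by linarith
    then have "norm (z - x) - lam * norm v \<le> sqrt \<bar>R\<bar>"
      by (rule real_le_rsqrt)
    then show ?thesis using 2 3 by (simp add: zt)
  qed
  define M where "M = lam * norm v + sqrt \<bar>R\<bar>"
  have "bounded C"
  proof (rule bounded_subset)
    show "bounded (cball x M \<times> {- norm v * (norm x + M) + c .. t0})"
      by (intro bounded_Times) auto
    show "C \<subseteq> cball x M \<times> {- norm v * (norm x + M) + c .. t0}"
    proof
      fix w assume w: "w \<in> C"
      have n: "norm (fst w - x) \<le> M" using bnd[OF w] by (simp add: M_def)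
      have "norm (fst w) \<le> norm x + M" using n norm_triangle_ineq[of x "fst w - x"] by simp
      then have "norm v * norm (fst w) \<le> norm v * (norm x + M)" by (rule mult_left_mono) simp
      moreover have "- (norm v * norm (fst w)) \<le> v \<bullet> fst w"
        using Cauchy_Schwarz_ineq2[of v "fst w"] by linarith
      ultimately show "w \<in> cball x M \<times> {- norm v * (norm x + M) + c .. t0}"
        using bnd[OF w] n by (cases w) (auto simp: dist_norm norm_minus_commute)
    qed
  qed
  with closed have "compact C" by (simp add: compact_eq_bounded_closed)
  moreover have "(x0, real_of_ereal (h x0)) \<in> C"
    using x0 le_ereal_iff_edom[OF assms(1)] by (auto simp: C_def t0_def)
  moreover have "continuous_on C (\<lambda>w. snd w + ?q (fst w))"
    by (intro continuous_intros) (use assms(4) in auto)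
  ultimately obtain w where w: "w \<in> C"
    "\<And>w'. w' \<in> C \<Longrightarrow> snd w + ?q (fst w) \<le> snd w' + ?q (fst w')"
    using continuous_attains_inf[of C "\<lambda>w. snd w + ?q (fst w)"] by blast
  obtain p t where pt: "w = (p, t)" by (cases w)
  have p: "p \<in> edom h" "real_of_ereal (h p) \<le> t" "t + ?q p \<le> t0"
    using w(1) le_ereal_iff_edom[OF assms(1)] by (auto simp: C_def pt)
  have "real_of_ereal (h p) + ?q p \<le> real_of_ereal (h z) + ?q z" if z: "z \<in> edom h" for z
  proof (cases "real_of_ereal (h z) + ?q z \<le> t0")
    case True
    then have "(z, real_of_ereal (h z)) \<in> C"
      using z le_ereal_iff_edom[OF assms(1)] by (auto simp: C_def)
    from w(2)[OF this] p(2) show ?thesis by (simp add: pt)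
  next
    case False
    then show ?thesis using p by linarith
  qed
  then show ?thesis using p(1) by blast
qed

lemma le_of_le_add_small:
  fixes A B C :: real
  assumes "\<And>s. 0 < s \<Longrightarrow> s < 1 \<Longrightarrow> A \<le> B + s * C"
  shows "A \<le> B"
proof (rule tendsto_lowerbound)
  show "((\<lambda>s. B + s * C) \<longlongrightarrow> B) (at_right 0)"
    by (auto intro!: tendsto_eq_intros)
  show "eventually (\<lambda>s. A \<le> B + s * C) (at_right (0::real))"
    unfolding eventually_at_right_field using assms by (intro exI[of _ 1]) auto
qed simp

text \<open>First-order optimality by comparison with the points of the segment from the minimiser
  towards \<open>z\<close>: convexity bounds the values of \<open>h\<close> linearly in
  \<open>s\<close>, the quadratic contributes a remainder of order \<open>s\<^sup>2\<close>, and
  after division by \<open>s\<close> the remainder disappears in the limit.\<close>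

lemma prox_variational:
  fixes h :: "'a::euclidean_space \<Rightarrow> ereal"
  assumes "proper_fun h" "closed_fun h" "convex_fun h" "lam > 0"
  shows "prox lam h x \<in> edom h"
    and "z \<in> edom h \<Longrightarrow> lam * (real_of_ereal (h (prox lam h x)) - real_of_ereal (h z))
      \<le> (x - prox lam h x) \<bullet> (prox lam h x - z)"
proof -
  define p where "p = prox lam h x"
  let ?q = "\<lambda>z. (norm (z - x))\<^sup>2 / (2 * lam)"
  let ?r = "\<lambda>z. real_of_ereal (h z)"
  obtain p0 where p0: "p0 \<in> edom h" "\<And>z. z \<in> edom h \<Longrightarrow> ?r p0 + ?q p0 \<le> ?r z + ?q z"
    using prox_minimizer_exists[OF assms] by blast
  \<comment> \<open>\<open>arg_min\<close> is a choice operator, so the existence of some minimiser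
    is what turns the chosen point into one.\<close>
  have "is_arg_min (\<lambda>z. h z + ereal (?q z)) (\<lambda>_. True) p0"
    unfolding is_arg_min_linorder
  proof (intro conjI allI impI)
    fix z
    show "h p0 + ereal (?q p0) \<le> h z + ereal (?q z)"
    proof (cases "z \<in> edom h")
      case True
      then show ?thesis
        using p0(2)[OF True] ereal_real_edom[OF assms(1) True] ereal_real_edom[OF assms(1) p0(1)]
        by (metis ereal_less_eq(3) plus_ereal.simps(1))
    qed (simp add: edom_def)
  qed simp
  then have "is_arg_min (\<lambda>z. h z + ereal (?q z)) (\<lambda>_. True) p"
    unfolding p_def prox_def arg_min_def by (rule someI)
  then have p: "h p + ereal (?q p) \<le> h z + ereal (?q z)" for z
    by (simp add: is_arg_min_linorder)
  have pd: "p \<in> edom h"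
    using p[of p0] ereal_real_edom[OF assms(1) p0(1)]
    by (cases "h p0") (auto simp: edom_def)
  then show "prox lam h x \<in> edom h" by (simp add: p_def)
  have pr: "?r p + ?q p \<le> ?r z + ?q z" if "z \<in> edom h" for z
    using p[of z] ereal_real_edom[OF assms(1) that] ereal_real_edom[OF assms(1) pd]
    by (metis ereal_less_eq(3) plus_ereal.simps(1))
  assume z: "z \<in> edom h"
  have "lam * (?r p - ?r z) \<le> (x - p) \<bullet> (p - z) + s * ((norm (z - p))\<^sup>2 / 2)"
    if s: "0 < s" "s < 1" for s
  proof -
    let ?w = "(1 - s) *\<^sub>R p + s *\<^sub>R z"
    have w: "?w \<in> edom h" "?r ?w \<le> (1 - s) * ?r p + s * ?r z"
      using convex_fun_edom[OF assms(1,3) pd z] s by auto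
    have "?w - x = (p - x) + s *\<^sub>R (z - p)" by (simp add: algebra_simps)
    then have n: "(norm (?w - x))\<^sup>2 = (norm (p - x))\<^sup>2 + 2 * s * ((p - x) \<bullet> (z - p)) + s\<^sup>2 * (norm (z - p))\<^sup>2"
      by (simp only: power2_norm_eq_inner) (simp add: inner_simps inner_commute algebra_simps power2_eq_square)
    have "?r p + ?q p \<le> (1 - s) * ?r p + s * ?r z + ?q ?w" using pr[OF w(1)] w(2) by linarith
    then have "s * (?r p - ?r z) \<le> ?q ?w - ?q p" by (simp add: algebra_simps)
    also have "\<dots> = s * (((p - x) \<bullet> (z - p) + s * ((norm (z - p))\<^sup>2 / 2)) / lam)"
      unfolding n using assms(4) by (simp add: field_simps power2_eq_square)
    finally have "?r p - ?r z \<le> ((p - x) \<bullet> (z - p) + s * ((norm (z - p))\<^sup>2 / 2)) / lam"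
      using s by (simp only: mult_le_cancel_left_pos)
    then have "lam * (?r p - ?r z) \<le> (p - x) \<bullet> (z - p) + s * ((norm (z - p))\<^sup>2 / 2)"
      using assms(4) by (simp add: field_simps)
    moreover have "(p - x) \<bullet> (z - p) = (x - p) \<bullet> (p - z)"
      by (simp add: inner_simps)
    ultimately show ?thesis by simp
  qed
  then show "lam * (?r (prox lam h x) - ?r z) \<le> (x - prox lam h x) \<bullet> (prox lam h x - z)"
    unfolding p_def[symmetric] by (rule le_of_le_add_small)
qed

section \<open>Conjugate functions and saddle points in terms of real values\<close>

lemma conj_fun_le_iff:
  assumes "proper_fun f"
  shows "conj_fun f y \<le> ereal t \<longleftrightarrow> (\<forall>x\<in>edom f. x \<bullet> y - real_of_ereal (f x) \<le> t)"
proof -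
  have "ereal (x \<bullet> y) - f x \<le> ereal t \<longleftrightarrow> (x \<in> edom f \<longrightarrow> x \<bullet> y - real_of_ereal (f x) \<le> t)" for x
    using assms by (cases "f x") (auto simp: edom_def proper_fun_def)
  then show ?thesis unfolding conj_fun_def by (auto simp: SUP_le_iff)
qed

lemma closed_conj_fun: "proper_fun f \<Longrightarrow> closed_fun (conj_fun f)"
  for f :: "'a::euclidean_space \<Rightarrow> ereal"
proof -
  assume f: "proper_fun f"
  have "{(y, t::real). conj_fun f y \<le> ereal t} =
      (\<Inter>x\<in>edom f. {w. x \<bullet> fst w - real_of_ereal (f x) \<le> snd w})"
    using conj_fun_le_iff[OF f] by auto
  moreover have "closed {w::'a \<times> real. x \<bullet> fst w - real_of_ereal (f x) \<le> snd w}" for x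
    by (intro closed_Collect_le continuous_intros)
  ultimately show ?thesis unfolding closed_fun_def by auto
qed

lemma convex_conj_fun: "proper_fun f \<Longrightarrow> convex_fun (conj_fun f)"
  for f :: "'a::euclidean_space \<Rightarrow> ereal"
proof -
  assume f: "proper_fun f"
  have "{(y, t::real). conj_fun f y \<le> ereal t} =
      (\<Inter>x\<in>edom f. {w. (x, -1) \<bullet> w \<le> real_of_ereal (f x)})"
    using conj_fun_le_iff[OF f] by (auto simp: inner_Pair algebra_simps)
  then show ?thesis unfolding convex_fun_def by (auto intro!: convex_INT convex_halfspace_le)
qed

lemma proper_conj_fun:
  fixes f :: "'a::euclidean_space \<Rightarrow> ereal"
  assumes "proper_fun f" "closed_fun f" "convex_fun f"
  shows "proper_fun (conj_fun f)"
proof -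
  obtain v c where vc: "\<And>x. x \<in> edom f \<Longrightarrow> v \<bullet> x + c \<le> real_of_ereal (f x)"
    using affine_minorant[OF assms] by blast
  then have "conj_fun f v \<le> ereal (- c)"
    unfolding conj_fun_le_iff[OF assms(1)] by (fastforce simp: inner_commute)
  moreover have "conj_fun f y \<noteq> - \<infinity>" for y
  proof
    assume y: "conj_fun f y = - \<infinity>"
    obtain x0 where x0: "x0 \<in> edom f" using edom_nonempty[OF assms(1)] by blast
    have "conj_fun f y \<le> ereal (x0 \<bullet> y - real_of_ereal (f x0) - 1)" by (simp add: y)
    then show False using x0 unfolding conj_fun_le_iff[OF assms(1)] by fastforce
  qed
  ultimately show ?thesis unfolding proper_fun_def by (metis MInfty_neq_PInfty(1) PInfty_neq_ereal(1) ereal_infty_less_eq(1))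
qed

text \<open>Replaces the extended-valued definition by real inequalities over the two domains. An
  infinite coordinate at the saddle point is excluded by comparison with one point of the other
  function's or the same function's domain, which properness supplies.\<close>

lemma saddle_point_lagr_iff:
  fixes f :: "'b::euclidean_space \<Rightarrow> ereal"
  assumes g: "proper_fun g" and f: "proper_fun (conj_fun f)"
  shows "saddle_point (lagr K g f) xh yh \<longleftrightarrow>
    xh \<in> edom g \<and> yh \<in> edom (conj_fun f) \<and>
    (\<forall>x\<in>edom g. real_of_ereal (g xh) + K xh \<bullet> yh \<le> real_of_ereal (g x) + K x \<bullet> yh) \<and>
    (\<forall>y\<in>edom (conj_fun f). real_of_ereal (conj_fun f yh) - K xh \<bullet> yh
       \<le> real_of_ereal (conj_fun f y) - K xh \<bullet> y)"
    (is "?L \<longleftrightarrow> ?R")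
proof -
  let ?l = "lagr K g f"
  let ?F = "edom (conj_fun f)"
  have fin: "?l x y = ereal (real_of_ereal (g x) + K x \<bullet> y - real_of_ereal (conj_fun f y))"
    if "x \<in> edom g" "y \<in> ?F" for x y
    using ereal_real_edom[OF g that(1)] ereal_real_edom[OF f that(2)]
    unfolding lagr_def by (metis ereal_minus(1) plus_ereal.simps(1))
  \<comment> \<open>Extended reals evaluate \<infinity> - \<infinity> to \<infinity>, so this holds
    for every \<open>y\<close>; the counterpart \<open>bot\<close> has to ask for \<open>x\<close>
    in the domain.\<close>
  have top: "?l x y = \<infinity>" if "x \<notin> edom g" for x y
    using that unfolding lagr_def edom_def
    by (cases "conj_fun f y") auto
  have bot: "?l x y = - \<infinity>" if "x \<in> edom g" "y \<notin> ?F" for x y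
    using ereal_real_edom[OF g that(1)] that(2) unfolding lagr_def edom_def
    by (cases "g x") auto
  obtain x0 where x0: "x0 \<in> edom g" using edom_nonempty[OF g] by blast
  obtain y0 where y0: "y0 \<in> ?F" using edom_nonempty[OF f] by blast
  show ?thesis
  proof
    assume L: ?L
    then have s1: "?l xh y \<le> ?l xh yh" and s2: "?l xh yh \<le> ?l x yh" for x y
      unfolding saddle_point_def by blast+
    have xh: "xh \<in> edom g"
    proof (rule ccontr)
      assume "xh \<notin> edom g"
      with s2[of x0] top have "?l x0 yh = \<infinity>" by simp
      then show False using fin[OF x0, of yh] bot[OF x0, of yh] by (cases "yh \<in> ?F") auto
    qed
    have yh: "yh \<in> ?F"
    proof (rule ccontr)
      assume "yh \<notin> ?F"
      with s1[of y0] bot[OF xh] have "?l xh y0 = - \<infinity>" by simp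
      then show False using fin[OF xh y0] by auto
    qed
    show ?R
    proof (intro conjI ballI xh yh)
      fix x assume "x \<in> edom g"
      then show "real_of_ereal (g xh) + K xh \<bullet> yh \<le> real_of_ereal (g x) + K x \<bullet> yh"
        using s2[of x] fin[OF xh yh] fin[OF _ yh, of x] by simp
    next
      fix y assume "y \<in> ?F"
      then show "real_of_ereal (conj_fun f yh) - K xh \<bullet> yh \<le> real_of_ereal (conj_fun f y) - K xh \<bullet> y"
        using s1[of y] fin[OF xh yh] fin[OF xh, of y] by simp
    qed
  next
    assume R: ?R
    have "?l xh y \<le> ?l xh yh" for y
      using R fin[of xh y] fin[of xh yh] bot[of xh y] by (cases "y \<in> ?F") force+
    moreover have "?l xh yh \<le> ?l x yh" for x
      using R fin[of x yh] fin[of xh yh] top[of x yh] by (cases "x \<in> edom g") force+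
    ultimately show ?L unfolding saddle_point_def by blast
  qed
qed

section \<open>Averaged sequences\<close>

lemma antimono_telescoping:
  fixes M r :: "nat \<Rightarrow> real"
  assumes "\<And>n. 0 \<le> r n" "\<And>n. 0 \<le> M n" "\<And>n. M (Suc n) + r n \<le> M n"
  shows "convergent M" "r \<longlonglongrightarrow> 0"
proof -
  have "decseq M" using assms(1,3) by (intro decseq_SucI) (smt (verit))
  then show c: "convergent M"
    using assms(2) by (metis decseq_convergent convergent_def)
  then obtain L where L: "M \<longlonglongrightarrow> L" by (auto simp: convergent_def)
  have "(\<lambda>n. M n - M (Suc n)) \<longlonglongrightarrow> L - L"
    by (intro tendsto_diff L LIMSEQ_Suc)
  then have "(\<lambda>n. M n - M (Suc n)) \<longlonglongrightarrow> 0" by simp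
  then show "r \<longlonglongrightarrow> 0"
    by (rule tendsto_sandwich[OF _ _ tendsto_const, rotated 2])
       (use assms(1,3) in \<open>auto intro!: always_eventually simp: algebra_simps\<close>)
qed

text \<open>The truncation \<open>max (u n) c\<close> is eventually non-increasing, hence
  convergent. The subsequence identifies its limit as \<open>l\<close>, and because \<open>l\<close>
  exceeds \<open>c\<close> the truncation is eventually inactive.\<close>

lemma converges_of_subseq_above:
  fixes u :: "nat \<Rightarrow> real"
  assumes step: "eventually (\<lambda>n. u (Suc n) \<le> max (u n) c) sequentially"
    and r: "strict_mono (r :: nat \<Rightarrow> nat)" "(u \<circ> r) \<longlonglongrightarrow> l" and "c < l"
  shows "u \<longlonglongrightarrow> l"
proof -
  define m where "m n = max (u n) c" for n
  obtain N where N: "\<And>n. n \<ge> N \<Longrightarrow> m (Suc n) \<le> m n"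
    using step by (auto simp: eventually_sequentially m_def)
  have "decseq (\<lambda>n. m (n + N))" by (intro decseq_SucI) (simp add: N)
  then obtain L where "(\<lambda>n. m (n + N)) \<longlonglongrightarrow> L"
    using decseq_convergent[of "\<lambda>n. m (n + N)" c] by (auto simp: m_def)
  then have L: "m \<longlonglongrightarrow> L" by (simp add: LIMSEQ_offset)
  have "(\<lambda>n. max ((u \<circ> r) n) c) \<longlonglongrightarrow> max l c" by (intro tendsto_intros r)
  then have "(m \<circ> r) \<longlonglongrightarrow> l" using \<open>c < l\<close> by (simp add: m_def comp_def)
  moreover have "(m \<circ> r) \<longlonglongrightarrow> L" using L r(1) by (rule LIMSEQ_subseq_LIMSEQ)
  ultimately have "L = l" by (metis LIMSEQ_unique)
  with L have ml: "m \<longlonglongrightarrow> l" by simp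
  then have "eventually (\<lambda>n. c < m n) sequentially" using \<open>c < l\<close> by (rule order_tendstoD(1))
  then have "eventually (\<lambda>n. m n = u n) sequentially" by eventually_elim (auto simp: m_def)
  then show ?thesis using ml by (rule Lim_transform_eventually[rotated])
qed

lemma bounded_away_subseq:
  fixes u :: "nat \<Rightarrow> 'a::euclidean_space"
  assumes "bounded (range u)" "\<not> u \<longlonglongrightarrow> p"
  obtains r l where "strict_mono (r :: nat \<Rightarrow> nat)" "(u \<circ> r) \<longlonglongrightarrow> l" "l \<noteq> p"
proof -
  obtain e where e: "e > 0" "\<exists>\<^sub>\<infinity>n. e \<le> dist (u n) p"
    using assms(2) unfolding tendsto_iff
    by (auto simp: not_less not_eventually cofinite_eq_sequentially)
  then obtain s :: "nat \<Rightarrow> nat" where s: "strict_mono s" "\<And>n. e \<le> dist (u (s n)) p"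
    using infinite_enumerate[of "{n. e \<le> dist (u n) p}"]
    by (auto simp: INFM_iff_infinite)
  have "bounded (range (u \<circ> s))" using assms(1) by (rule bounded_subset) auto
  then obtain l t where t: "strict_mono (t :: nat \<Rightarrow> nat)" "((u \<circ> s) \<circ> t) \<longlonglongrightarrow> l"
    using bounded_imp_convergent_subsequence by blast
  have "e \<le> dist l p"
  proof (rule tendsto_lowerbound)
    show "(\<lambda>n. dist (((u \<circ> s) \<circ> t) n) p) \<longlonglongrightarrow> dist l p" by (intro tendsto_intros t)
  qed (use s in auto)
  then have "l \<noteq> p" using e by auto
  then show ?thesis using that[of "s \<circ> t" l] t s(1) by (simp add: strict_mono_o comp_assoc)
qed

text \<open>The hypotheses say that moves away from 0 happen only below arbitrarily small levels. If
  \<open>u\<close> does not tend to 0, it has a cluster point \<open>l\<close> other than 0, and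
  truncating \<open>u\<close> or \<open>- u\<close> at half of its modulus gives convergence to
  \<open>l\<close>.\<close>

lemma convergent_of_max_steps:
  fixes u :: "nat \<Rightarrow> real"
  assumes b: "bounded (range u)"
    and up: "\<And>e. e > 0 \<Longrightarrow> eventually (\<lambda>n. u (Suc n) \<le> max (u n) e) sequentially"
    and dn: "\<And>e. e > 0 \<Longrightarrow> eventually (\<lambda>n. - u (Suc n) \<le> max (- u n) e) sequentially"
  shows "convergent u"
proof (cases "u \<longlonglongrightarrow> 0")
  case True
  then show ?thesis by (auto simp: convergent_def)
next
  case False
  then obtain r l where r: "strict_mono (r :: nat \<Rightarrow> nat)" "(u \<circ> r) \<longlonglongrightarrow> l" "l \<noteq> 0"
    using bounded_away_subseq[OF b] by blast
  show ?thesis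
  proof (cases "l > 0")
    case True
    then have "u \<longlonglongrightarrow> l"
      using converges_of_subseq_above[OF up[of "l/2"] r(1,2)] by simp
    then show ?thesis by (auto simp: convergent_def)
  next
    case False
    have "((\<lambda>n. - u n) \<circ> r) \<longlonglongrightarrow> - l" using tendsto_minus[OF r(2)] by (simp add: comp_def)
    then have "(\<lambda>n. - u n) \<longlonglongrightarrow> - l"
      using converges_of_subseq_above[OF dn[of "- l/2"] r(1), of "- l"] False r(3) by simp
    then show ?thesis by (metis convergent_def tendsto_minus_cancel_left)
  qed
qed

text \<open>Eliminating \<open>s\<close> gives
  \<open>z (Suc n) = (1 - c n)\<^sup>2 * z n + c n * e n\<close> with \<open>e\<close> tending to 0,
  and the two coefficients add up to at most 1. If \<open>c\<close> is summable, \<open>z\<close>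
  can have a limit other than 0; what survives in general is that it converges.\<close>

lemma averaging_convergent:
  fixes s w c :: "nat \<Rightarrow> real"
  assumes c: "\<And>n. 0 \<le> c n" "\<And>n. c n \<le> 1" "convergent c"
    and w: "\<And>n. w (Suc n) = (1 - c n) * w n + c n * s n" "bounded (range w)"
    and l: "convergent (\<lambda>n. s n + (1 - c n) * w n)"
  shows "convergent s"
proof -
  obtain c' where c': "c \<longlonglongrightarrow> c'" using c(3) by (auto simp: convergent_def)
  have "c' \<le> 1" using c' by (rule LIMSEQ_le_const2) (use c in auto)
  obtain l where l': "(\<lambda>n. s n + (1 - c n) * w n) \<longlonglongrightarrow> l" using l by (auto simp: convergent_def)
  \<comment> \<open>The fixed point of the recursion for \<open>w\<close> in which \<open>s\<close>
    has been replaced by \<open>l - (1 - c) * w\<close>: the factor \<open>c\<close> cancels and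
    \<open>(2 - c) * m = l\<close> remains.\<close>
  define m where "m = l / (2 - c')"
  define z where "z n = w n - m" for n
  define e where "e n = s n + (1 - c n) * w n - (2 - c n) * m" for n
  have "e \<longlonglongrightarrow> l - (2 - c') * m" unfolding e_def by (intro tendsto_intros l' c')
  then have e0: "e \<longlonglongrightarrow> 0" using \<open>c' \<le> 1\<close> by (simp add: m_def)
  have z: "z (Suc n) = (1 - c n)\<^sup>2 * z n + c n * e n" for n
    by (simp add: z_def e_def w(1) power2_eq_square algebra_simps)
  have step: "(1 - c n)\<^sup>2 * v + c n * d \<le> max v t" if "0 < t" "d \<le> t" for n v d t
  proof -
    have "(1 - c n)\<^sup>2 * v \<le> (1 - c n)\<^sup>2 * max v t" by (intro mult_left_mono) auto
    moreover have "c n * d \<le> c n * max v t" using c(1)[of n] that by (intro mult_left_mono) auto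
    moreover have "((1 - c n)\<^sup>2 + c n) * max v t \<le> 1 * max v t"
    proof (rule mult_right_mono)
      have "c n * c n \<le> c n * 1" using c(1,2)[of n] by (intro mult_left_mono) auto
      then show "(1 - c n)\<^sup>2 + c n \<le> 1" by (simp add: power2_eq_square algebra_simps)
    qed (use that in auto)
    ultimately show ?thesis by (simp add: distrib_right)
  qed
  have "convergent z"
  proof (rule convergent_of_max_steps)
    obtain B where "\<And>n. norm (w n) \<le> B" using w(2) by (auto simp: bounded_iff)
    then have "norm (z n) \<le> B + norm m" for n
      unfolding z_def using norm_triangle_ineq4[of "w n" m] by (smt (verit))
    then show "bounded (range z)" by (auto simp: bounded_iff)
  next
    fix t :: real assume t: "t > 0"
    have "eventually (\<lambda>n. e n < t) sequentially" using order_tendstoD(2)[OF e0 t] .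
    then show "eventually (\<lambda>n. z (Suc n) \<le> max (z n) t) sequentially"
      by eventually_elim (simp only: z, rule step, use t in auto)
    have "eventually (\<lambda>n. - t < e n) sequentially" using order_tendstoD(1)[OF e0, of "-t"] t by simp
    then show "eventually (\<lambda>n. - z (Suc n) \<le> max (- z n) t) sequentially"
    proof eventually_elim
      case (elim n)
      have "- z (Suc n) = (1 - c n)\<^sup>2 * (- z n) + c n * (- e n)" by (simp add: z)
      also have "\<dots> \<le> max (- z n) t" by (rule step) (use t elim in auto)
      finally show ?case .
    qed
  qed
  then obtain z' where z': "z \<longlonglongrightarrow> z'" by (auto simp: convergent_def)
  have "(\<lambda>n. z n + m) \<longlonglongrightarrow> z' + m" by (intro tendsto_intros z')
  then have w': "w \<longlonglongrightarrow> z' + m" by (simp add: z_def)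
  have "(\<lambda>n. (s n + (1 - c n) * w n) - (1 - c n) * w n) \<longlonglongrightarrow> l - (1 - c') * (z' + m)"
    by (intro tendsto_intros l' c' w')
  then show ?thesis by (auto simp: convergent_def)
qed

text \<open>Opial's argument with the convergent quantity being a sum over iterate and average. The
  differences \<open>diff\<close> determine \<open>u n \<bullet> (p - q)\<close> only up to the same
  expression in the average; \<open>averaging_convergent\<close> separates the two, and then two
  distinct cluster points contradict each other.\<close>

lemma averaging_opial:
  fixes u w :: "nat \<Rightarrow> 'a::euclidean_space" and c :: "nat \<Rightarrow> real"
  assumes c: "\<And>n. 0 \<le> c n" "\<And>n. c n \<le> 1" "convergent c"
    and w: "\<And>n. w (Suc n) = (1 - c n) *\<^sub>R w n + c n *\<^sub>R u n"
    and bw: "bounded (range w)" and bu: "bounded (range u)"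
    and clus: "\<And>r p. strict_mono (r :: nat \<Rightarrow> nat) \<Longrightarrow> (u \<circ> r) \<longlonglongrightarrow> p \<Longrightarrow> p \<in> S"
    and diff: "\<And>p q. p \<in> S \<Longrightarrow> q \<in> S \<Longrightarrow> convergent (\<lambda>n.
        ((norm (u n - p))\<^sup>2 + (1 - c n) * (norm (w n - p))\<^sup>2)
      - ((norm (u n - q))\<^sup>2 + (1 - c n) * (norm (w n - q))\<^sup>2))"
  shows "\<exists>p\<in>S. u \<longlonglongrightarrow> p"
proof -
  have conv: "convergent (\<lambda>n. u n \<bullet> (p - q))" if pq: "p \<in> S" "q \<in> S" for p q
  proof (rule averaging_convergent[OF c])
    show "w (Suc n) \<bullet> (p - q) = (1 - c n) * (w n \<bullet> (p - q)) + c n * (u n \<bullet> (p - q))" for n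
      by (simp add: w inner_add_left)
    show "bounded (range (\<lambda>n. w n \<bullet> (p - q)))"
      using bounded_linear_image[OF bw bounded_linear_inner_left[of "p - q"]]
      by (simp add: image_image)
    let ?d = "\<lambda>n. ((norm (u n - p))\<^sup>2 + (1 - c n) * (norm (w n - p))\<^sup>2)
      - ((norm (u n - q))\<^sup>2 + (1 - c n) * (norm (w n - q))\<^sup>2)"
    obtain L where L: "?d \<longlonglongrightarrow> L" using diff[OF pq] by (auto simp: convergent_def)
    obtain c' where c': "c \<longlonglongrightarrow> c'" using c(3) by (auto simp: convergent_def)
    \<comment> \<open>The squares of \<open>u n\<close> and \<open>w n\<close> cancel in
      \<open>?d\<close>, so solving for the inner products with \<open>p - q\<close> yields a
      convergent sequence.\<close>
    have "(\<lambda>n. ((2 - c n) * ((norm p)\<^sup>2 - (norm q)\<^sup>2) - ?d n) / 2)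
        \<longlonglongrightarrow> ((2 - c') * ((norm p)\<^sup>2 - (norm q)\<^sup>2) - L) / 2"
      by (intro tendsto_intros L c') simp
    moreover have "((2 - c n) * ((norm p)\<^sup>2 - (norm q)\<^sup>2) - ?d n) / 2
        = u n \<bullet> (p - q) + (1 - c n) * (w n \<bullet> (p - q))" for n
      unfolding power2_norm_eq_inner by (simp add: inner_simps inner_commute field_simps)
    ultimately show "convergent (\<lambda>n. u n \<bullet> (p - q) + (1 - c n) * (w n \<bullet> (p - q)))"
      by (auto simp: convergent_def)
  qed
  obtain p r where r: "strict_mono (r :: nat \<Rightarrow> nat)" "(u \<circ> r) \<longlonglongrightarrow> p"
    using bounded_imp_convergent_subsequence[OF bu] by blast
  have "u \<longlonglongrightarrow> p"
  proof (rule ccontr)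
    assume "\<not> u \<longlonglongrightarrow> p"
    then obtain t q where t: "strict_mono (t :: nat \<Rightarrow> nat)" "(u \<circ> t) \<longlonglongrightarrow> q" "q \<noteq> p"
      using bounded_away_subseq[OF bu] by blast
    obtain L where L: "(\<lambda>n. u n \<bullet> (p - q)) \<longlonglongrightarrow> L"
      using conv[OF clus[OF r] clus[OF t(1,2)]] by (auto simp: convergent_def)
    have "(\<lambda>n. (u \<circ> r) n \<bullet> (p - q)) \<longlonglongrightarrow> p \<bullet> (p - q)" by (intro tendsto_intros r)
    moreover have "(\<lambda>n. (u \<circ> r) n \<bullet> (p - q)) \<longlonglongrightarrow> L"
      using LIMSEQ_subseq_LIMSEQ[OF L r(1)] by (simp add: comp_def)
    ultimately have 1: "p \<bullet> (p - q) = L" by (rule LIMSEQ_unique)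
    have "(\<lambda>n. (u \<circ> t) n \<bullet> (p - q)) \<longlonglongrightarrow> q \<bullet> (p - q)" by (intro tendsto_intros t)
    moreover have "(\<lambda>n. (u \<circ> t) n \<bullet> (p - q)) \<longlonglongrightarrow> L"
      using LIMSEQ_subseq_LIMSEQ[OF L t(1)] by (simp add: comp_def)
    ultimately have "q \<bullet> (p - q) = L" by (rule LIMSEQ_unique)
    with 1 have "(p - q) \<bullet> (p - q) = 0" by (simp add: inner_diff_left)
    then show False using t(3) by simp
  qed
  then show ?thesis using clus[OF r] by blast
qed

section \<open>The one-step estimate\<close>

lemma young_inner:
  fixes u v :: "'a::real_inner"
  assumes "0 \<le> s" "0 \<le> t" "c\<^sup>2 \<le> s * t"
  shows "2 * c * (u \<bullet> v) \<le> s * (norm u)\<^sup>2 + t * (norm v)\<^sup>2"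
proof -
  have "\<bar>c\<bar> \<le> sqrt s * sqrt t"
    using assms by (metis real_sqrt_abs real_sqrt_le_mono real_sqrt_mult)
  then have "\<bar>c\<bar> * \<bar>u \<bullet> v\<bar> \<le> (sqrt s * sqrt t) * (norm u * norm v)"
    by (intro mult_mono Cauchy_Schwarz_ineq2) (use assms in auto)
  then have "2 * c * (u \<bullet> v) \<le> 2 * ((sqrt s * norm u) * (sqrt t * norm v))"
    using abs_ge_self[of "c * (u \<bullet> v)"] by (simp add: abs_mult mult_ac)
  also have "\<dots> \<le> (sqrt s * norm u)\<^sup>2 + (sqrt t * norm v)\<^sup>2"
    using sum_squares_bound[of "sqrt s * norm u" "sqrt t * norm v"] by simp
  finally show ?thesis using assms(1,2) by (simp add: power_mult_distrib)
qed

text \<open>The two sides differ by exactly \<open>c ^ 3 * (1 - c) * (norm (u - w))\<^sup>2\<close>.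
  The vector \<open>u - c *\<^sub>R (u - w')\<close> is the base point of a proximal step; the lemma
  trades its distance for those of the iterate and of the old average, and the gain
  \<open>2 * c * (norm (u - w'))\<^sup>2\<close> later pays for cross terms.\<close>

lemma averaging_contraction:
  fixes u w z :: "'a::real_inner"
  assumes "0 \<le> c" "c \<le> 1" and w': "w' = (1 - c) *\<^sub>R w + c *\<^sub>R u"
  shows "(norm (u - c *\<^sub>R (u - w') - z))\<^sup>2 + (1 - c) * (norm (w' - z))\<^sup>2 + 2 * c * (norm (u - w'))\<^sup>2
    \<le> (norm (u - z))\<^sup>2 + (1 - c) * (norm (w - z))\<^sup>2"
proof -
  define d e where "d = u - w" and "e = u - z"
  have 1: "u - w' = (1 - c) *\<^sub>R d" "w' - z = e - (1 - c) *\<^sub>R d" "w - z = e - d"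
    "u - c *\<^sub>R (u - w') - z = e - (c * (1 - c)) *\<^sub>R d"
    unfolding w' d_def e_def by (simp_all add: algebra_simps)
  have "(norm e)\<^sup>2 + (1 - c) * (norm (e - d))\<^sup>2 - ((norm (e - (c * (1 - c)) *\<^sub>R d))\<^sup>2
      + (1 - c) * (norm (e - (1 - c) *\<^sub>R d))\<^sup>2 + 2 * c * (norm ((1 - c) *\<^sub>R d))\<^sup>2)
      = c ^ 3 * (1 - c) * (norm d)\<^sup>2"
    unfolding power2_norm_eq_inner
    by (simp add: inner_simps inner_commute algebra_simps power2_eq_square power3_eq_cube)
  moreover have "0 \<le> c ^ 3 * (1 - c) * (norm d)\<^sup>2" using assms(1,2) by simp
  ultimately show ?thesis unfolding 1(4) unfolding 1(1-3) e_def[symmetric] by linarith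
qed

text \<open>Summing the three primal prox inequalities (tested at the solution, and, for the previous
  step, at the next and at the preceding iterate) with the dual one cancels all bilinear terms
  except the one controlled by the linesearch.\<close>

lemma prox_inequalities_combined:
  fixes x0 x1 x2 xh d1 d2 k0 k1 kh :: "'a::real_inner"
  assumes T: "t1 = th * t0" "0 \<le> th" "0 \<le> t1"
    and i1: "t1 * (g2 - gh) \<le> (d2 - t1 *\<^sub>R k1) \<bullet> (x2 - xh)"
    and i2: "t0 * (g1 - g2) \<le> (d1 - t0 *\<^sub>R k0) \<bullet> (x1 - x2)"
    and i3: "t0 * (g1 - g0) \<le> (d1 - t0 *\<^sub>R k0) \<bullet> (x1 - x0)"
    and i4: "t1 * (f1 - fh) \<le> dy + t1 * ((x1 + th *\<^sub>R (x1 - x0)) \<bullet> (k1 - kh))"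
    and i5: "fh - xh \<bullet> kh \<le> f1 - xh \<bullet> k1"
    and p: "p = x2 - (x1 + th *\<^sub>R (x1 - x0))"
  shows "t1 * ((1 + th) * (g1 - gh + (x1 - xh) \<bullet> kh) - th * (g0 - gh + (x0 - xh) \<bullet> kh))
    \<le> d2 \<bullet> (x2 - xh) + dy - th * (d1 \<bullet> p) - t1 * ((k1 - k0) \<bullet> p)"
proof -
  \<comment> \<open>The multipliers \<open>th\<close> and \<open>th\<^sup>2\<close> turn the old
    step size \<open>t0\<close> into \<open>t1\<close> and \<open>th * t1\<close>. With them
    \<open>g2\<close> cancels, and the values of the primal function combine to
    \<open>(1 + th) * g1 - th * g0 - gh\<close>.\<close>
  have j2: "th * (t0 * (g1 - g2)) \<le> th * ((d1 - t0 *\<^sub>R k0) \<bullet> (x1 - x2))"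
    using i2 T(2) by (rule mult_left_mono)
  have j3: "th\<^sup>2 * (t0 * (g1 - g0)) \<le> th\<^sup>2 * ((d1 - t0 *\<^sub>R k0) \<bullet> (x1 - x0))"
    using i3 by (rule mult_left_mono) simp
  have j5: "t1 * (fh - xh \<bullet> kh) \<le> t1 * (f1 - xh \<bullet> k1)"
    using i5 T(3) by (rule mult_left_mono)
  show ?thesis
    using i1 j2 j3 i4 j5 unfolding p T(1)
    by (simp add: inner_simps inner_commute algebra_simps power2_eq_square)
qed

text \<open>The product of \<open>q\<close> and \<open>p\<close> cancels. Young's inequality splits
  the other three cross terms: the one with \<open>A0\<close> is charged to the anchor term of the
  previous step, and the weights of the remaining two are tuned so that \<open>p\<close> uses at
  most \<open>1 - h\<close> of its coefficient, \<open>q\<close> keeps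
  \<open>1 - 1 / (1 + h/2)\<close>, and \<open>A\<close> keeps \<open>h/2 * \<alpha>\<close> beyond
  the anchor term handed to the next step. In the application \<open>p\<close> is the deviation from
  the extrapolated point, \<open>q\<close> the extrapolation, and \<open>h\<close> is half of the
  slack \<eta>.\<close>

lemma primal_residual_bound:
  fixes p q A A0 :: "'a::real_inner"
  assumes "0 \<le> \<alpha>" "\<alpha> \<le> \<alpha>0" "0 < h" "\<delta> + \<theta>\<^sup>2 * \<alpha>0 + \<alpha>0 + 2 * h \<le> 1" "0 \<le> \<delta>"
    and "0 \<le> th" "th \<le> \<theta>"
  shows "- (norm (p + q + \<alpha> *\<^sub>R A))\<^sup>2 + 2 * ((q + (th * \<alpha>0) *\<^sub>R A0) \<bullet> p) + \<delta> * (norm p)\<^sup>2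
      - 2 * \<alpha> * (norm A)\<^sup>2
    \<le> \<alpha>0 * (norm A0)\<^sup>2 - \<alpha> * (norm A)\<^sup>2
      - (h * (norm p)\<^sup>2 + (1 - 1 / (1 + h/2)) * (norm q)\<^sup>2 + h / 2 * (\<alpha> * (norm A)\<^sup>2))"
proof -
  have a0: "0 \<le> \<theta>\<^sup>2 * \<alpha>0" using assms by simp
  have ah: "\<alpha> + h \<le> 1" "h \<le> 1" using assms a0 by linarith+
  have "2 * (th * \<alpha>0) * (A0 \<bullet> p) \<le> \<alpha>0 * (norm A0)\<^sup>2 + (th\<^sup>2 * \<alpha>0) * (norm p)\<^sup>2"
    by (rule young_inner) (use assms in \<open>auto simp: power2_eq_square algebra_simps\<close>)
  moreover have "(th\<^sup>2 * \<alpha>0) * (norm p)\<^sup>2 \<le> (\<theta>\<^sup>2 * \<alpha>0) * (norm p)\<^sup>2"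
    using assms by (intro mult_right_mono power_mono) auto
  ultimately have 1: "2 * (th * \<alpha>0) * (A0 \<bullet> p) \<le> \<alpha>0 * (norm A0)\<^sup>2 + (\<theta>\<^sup>2 * \<alpha>0) * (norm p)\<^sup>2"
    by linarith
  have "0 \<le> (\<alpha> * h) * (1 - \<alpha> - h)" using assms ah by (intro mult_nonneg_nonneg) auto
  then have "(- \<alpha>)\<^sup>2 \<le> (\<alpha> + h) * (\<alpha> * (1 - h))" by (simp add: power2_eq_square algebra_simps)
  then have 2: "2 * (- \<alpha>) * (p \<bullet> A) \<le> (\<alpha> + h) * (norm p)\<^sup>2 + (\<alpha> * (1 - h)) * (norm A)\<^sup>2"
    by (intro young_inner) (use assms ah in auto)
  have 3: "2 * (- \<alpha>) * (q \<bullet> A) \<le> 1 / (1 + h/2) * (norm q)\<^sup>2 + (\<alpha>\<^sup>2 * (1 + h/2)) * (norm A)\<^sup>2"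
    by (rule young_inner) (use assms in auto)
  have "\<alpha> * \<alpha> \<le> \<alpha> * 1" using assms ah by (intro mult_left_mono) auto
  then have "\<alpha>\<^sup>2 \<le> \<alpha>" by (simp add: power2_eq_square)
  moreover have "0 \<le> h/2" using assms(3) by simp
  ultimately have "\<alpha>\<^sup>2 * (h/2) \<le> \<alpha> * (h/2)" by (rule mult_right_mono)
  then have 4: "(\<alpha>\<^sup>2 * (h/2)) * (norm A)\<^sup>2 \<le> (\<alpha> * (h/2)) * (norm A)\<^sup>2" by (rule mult_right_mono) simp
  have "(\<delta> + \<theta>\<^sup>2 * \<alpha>0 + \<alpha> + 2 * h) * (norm p)\<^sup>2 \<le> 1 * (norm p)\<^sup>2"
    using assms by (intro mult_right_mono) auto
  then have 5: "(\<delta> + \<theta>\<^sup>2 * \<alpha>0 + \<alpha> + 2 * h) * (norm p)\<^sup>2 \<le> (norm p)\<^sup>2" by simp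
  have 6: "(norm (p + q + \<alpha> *\<^sub>R A))\<^sup>2 = (norm p)\<^sup>2 + (norm q)\<^sup>2 + \<alpha>\<^sup>2 * (norm A)\<^sup>2 + 2 * (q \<bullet> p)
      + 2 * \<alpha> * (p \<bullet> A) + 2 * \<alpha> * (q \<bullet> A)"
    unfolding power2_norm_eq_inner by (simp add: inner_simps inner_commute algebra_simps power2_eq_square)
  define Q where "Q = 1 / (1 + h/2) * (norm q)\<^sup>2"
  have "(1 - 1 / (1 + h/2)) * (norm q)\<^sup>2 = (norm q)\<^sup>2 - Q" by (simp add: Q_def algebra_simps)
  then show ?thesis
    using 1 2 3 4 5 unfolding 6 Q_def[symmetric] inner_add_left inner_scaleR_left
    by (simp add: algebra_simps)
qed

lemma dual_residual_bound:
  fixes d B :: "'a::real_inner"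
  assumes "0 \<le> \<gamma>" "\<delta> + \<gamma> + \<eta> \<le> 1"
  shows "- (norm (d + \<gamma> *\<^sub>R B))\<^sup>2 + \<delta> * (norm d)\<^sup>2 - 2 * \<gamma> * (norm B)\<^sup>2
    \<le> - (\<eta> * (norm d)\<^sup>2 + \<gamma> * (norm B)\<^sup>2)"
proof -
  have 1: "2 * (- \<gamma>) * (d \<bullet> B) \<le> \<gamma> * (norm d)\<^sup>2 + \<gamma> * (norm B)\<^sup>2"
    by (rule young_inner) (use assms in \<open>auto simp: power2_eq_square\<close>)
  have 2: "(\<delta> + \<gamma> + \<eta>) * (norm d)\<^sup>2 \<le> 1 * (norm d)\<^sup>2"
    using assms by (intro mult_right_mono) auto
  have 3: "(norm (d + \<gamma> *\<^sub>R B))\<^sup>2 = (norm d)\<^sup>2 + 2 * \<gamma> * (d \<bullet> B) + \<gamma>\<^sup>2 * (norm B)\<^sup>2"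
    unfolding power2_norm_eq_inner by (simp add: inner_simps inner_commute algebra_simps power2_eq_square)
  have 4: "0 \<le> \<gamma>\<^sup>2 * (norm B)\<^sup>2" by simp
  define M where "M = \<gamma>\<^sup>2 * (norm B)\<^sup>2"
  show ?thesis using 1 2 4 unfolding 3 M_def[symmetric] by (simp add: algebra_simps)
qed

text \<open>Indices follow the algorithm state: \<open>y n\<close>, \<open>ya n\<close> are the paper's $y_{n+1}$, $y^{ag}_{n+1}$, and
  \<open>\<alpha> n\<close>, \<open>\<gamma> n\<close> are its $a_{n+1}$, $b_{n+2}$.\<close>

locale primal_dual_linesearch =
  fixes K :: "'a::euclidean_space \<Rightarrow> 'b::euclidean_space" and Kt :: "'b \<Rightarrow> 'a"
    and G :: "'a set" and gr :: "'a \<Rightarrow> real" and H :: "'b set" and hr :: "'b \<Rightarrow> real"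
    and x xa :: "nat \<Rightarrow> 'a" and y ya :: "nat \<Rightarrow> 'b" and T Th \<alpha> \<gamma> :: "nat \<Rightarrow> real"
    and \<beta> \<mu> \<delta> \<theta> \<eta> tmin :: real
  assumes linear: "linear K" "linear Kt" and adj: "\<And>u v. K u \<bullet> v = u \<bullet> Kt v"
    and G_lim: "\<And>z c z' c'. (\<And>n. z n \<in> G) \<Longrightarrow> (\<And>n. gr (z n) \<le> c n) \<Longrightarrow>
      z \<longlonglongrightarrow> z' \<Longrightarrow> c \<longlonglongrightarrow> c' \<Longrightarrow> z' \<in> G \<and> gr z' \<le> c'"
    and H_lim: "\<And>z c z' c'. (\<And>n. z n \<in> H) \<Longrightarrow> (\<And>n. hr (z n) \<le> c n) \<Longrightarrow>
      z \<longlonglongrightarrow> z' \<Longrightarrow> c \<longlonglongrightarrow> c' \<Longrightarrow> z' \<in> H \<and> hr z' \<le> c'"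
    and \<beta>: "\<beta> > 0" and \<mu>: "0 < \<mu>" "\<mu> < 1" and \<delta>: "0 \<le> \<delta>" and \<eta>: "\<eta> > 0" and tmin: "tmin > 0"
    and \<alpha>: "\<And>n. 0 < \<alpha> n" "\<And>n. \<alpha> (Suc n) \<le> \<alpha> n" "\<And>n. \<delta> + \<theta>\<^sup>2 * \<alpha> n + \<alpha> n + \<eta> \<le> 1"
    and \<gamma>: "\<And>n. 0 < \<gamma> n" "\<And>n. \<gamma> (Suc n) \<le> \<gamma> n" "\<And>n. \<delta> + \<gamma> n + \<eta> \<le> 1"
    and T: "\<And>n. tmin \<le> T n" "\<And>n. T (Suc n) = Th (Suc n) * T n"
    and Th: "\<And>n. 0 < Th n" "\<And>n. Th n \<le> \<theta>"
    and Th_step: "\<And>n. Th (Suc n) = sqrt (1 + Th n) \<or> Th (Suc n) \<le> \<mu> * sqrt (1 + Th n)"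
    and xa_Suc: "\<And>n. xa (Suc n) = (1 - \<alpha> n) *\<^sub>R xa n + \<alpha> n *\<^sub>R x n"
    and ya_Suc: "\<And>n. ya (Suc n) = (1 - \<gamma> n) *\<^sub>R ya n + \<gamma> n *\<^sub>R y n"
    and x_mem: "\<And>n. x (Suc n) \<in> G"
    and x_var: "\<And>n u. u \<in> G \<Longrightarrow> T n * (gr (x (Suc n)) - gr u)
      \<le> (x n - \<alpha> n *\<^sub>R (x n - xa (Suc n)) - T n *\<^sub>R Kt (y n) - x (Suc n)) \<bullet> (x (Suc n) - u)"
    and y_mem: "\<And>n. y (Suc n) \<in> H"
    and y_var: "\<And>n v. v \<in> H \<Longrightarrow> \<beta> * T (Suc n) * (hr (y (Suc n)) - hr v)
      \<le> (y n - \<gamma> n *\<^sub>R (y n - ya (Suc n)) +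
          (\<beta> * T (Suc n)) *\<^sub>R K (x (Suc n) + Th (Suc n) *\<^sub>R (x (Suc n) - x n)) - y (Suc n))
        \<bullet> (y (Suc n) - v)"
    and linesearch: "\<And>n. sqrt \<beta> * T (Suc n) * norm (Kt (y (Suc n)) - Kt (y n))
      \<le> \<delta> * norm (y (Suc n) - y n)"
begin

section \<open>The Lyapunov function and its decrease\<close>

definition sol :: "'a \<Rightarrow> 'b \<Rightarrow> bool" where
  "sol p q \<longleftrightarrow> p \<in> G \<and> q \<in> H \<and> (\<forall>u\<in>G. gr p + K p \<bullet> q \<le> gr u + K u \<bullet> q) \<and>
     (\<forall>v\<in>H. hr q - K p \<bullet> q \<le> hr v - K p \<bullet> v)"

text \<open>The increase of the Lagrangian from \<open>p\<close> to \<open>u\<close> when the dual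
  variable is fixed at \<open>q\<close>.\<close>

definition gap :: "'a \<Rightarrow> 'b \<Rightarrow> 'a \<Rightarrow> real" where
  "gap p q u = gr u - gr p + (u - p) \<bullet> Kt q"

lemma sol_swap: "sol p q \<Longrightarrow> sol p' q' \<Longrightarrow> sol p q'"
  unfolding sol_def by (smt (verit))

lemma sol_primal: "sol p q \<Longrightarrow> u \<in> G \<Longrightarrow> gr p + p \<bullet> Kt q \<le> gr u + u \<bullet> Kt q"
  by (auto simp: sol_def adj)

lemma gap_nonneg: "sol p q \<Longrightarrow> u \<in> G \<Longrightarrow> 0 \<le> gap p q u"
  using sol_primal[of p q u] by (simp add: gap_def inner_diff_left)

text \<open>Both \<open>p\<close> and \<open>p'\<close> minimise the Lagrangian at the same dual
  point, so they give it the same value.\<close>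

lemma gap_primal_indep:
  assumes "sol p q" "sol p' q" shows "gap p q u = gap p' q u"
  using sol_primal[OF assms(1), of p'] sol_primal[OF assms(2), of p] assms
  by (simp add: gap_def inner_diff_left sol_def)

definition ex :: "nat \<Rightarrow> 'a" where
  "ex n = x (Suc n) + Th (Suc n) *\<^sub>R (x (Suc n) - x n)"

text \<open>The primal index is one ahead of the dual one, because a step combines the proximal
  inequalities of \<open>x (Suc (Suc n))\<close> and \<open>y (Suc n)\<close>. The gap carries the
  coefficient with which that combination charges the old iterate \<open>x n\<close>, and the last
  summand pays for the averaging displacement in the preceding primal step.\<close>

definition lyap :: "'a \<Rightarrow> 'b \<Rightarrow> nat \<Rightarrow> real" where
  "lyap p q n = ((norm (x (Suc n) - p))\<^sup>2 + (1 - \<alpha> (Suc n)) * (norm (xa (Suc n) - p))\<^sup>2)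
     + ((norm (y n - q))\<^sup>2 + (1 - \<gamma> n) * (norm (ya n - q))\<^sup>2) / \<beta>
     + 2 * T (Suc n) * Th (Suc n) * gap p q (x n)
     + \<alpha> n * (norm (x n - xa (Suc n)))\<^sup>2"

definition resid :: "nat \<Rightarrow> real" where
  "resid n = \<eta>/2 * (norm (x (Suc (Suc n)) - ex n))\<^sup>2
     + (1 - 1 / (1 + \<eta>/2/2)) * (norm (ex n - x (Suc n)))\<^sup>2
     + \<eta>/2/2 * (\<alpha> (Suc n) * (norm (x (Suc n) - xa (Suc (Suc n))))\<^sup>2)
     + (\<eta> * (norm (y (Suc n) - y n))\<^sup>2 + \<gamma> n * (norm (y n - ya (Suc n)))\<^sup>2) / \<beta>"

lemma T_pos: "0 < T n" using T(1)[of n] tmin by linarith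

lemma Th_nonneg: "0 \<le> Th n" using Th(1)[of n] by simp

lemma \<alpha>_le: "\<alpha> n \<le> 1 - \<eta>"
proof -
  have "0 \<le> \<theta>\<^sup>2 * \<alpha> n" using \<alpha>(1)[of n] by simp
  then show ?thesis using \<alpha>(3)[of n] \<delta> by linarith
qed

lemma \<gamma>_le: "\<gamma> n \<le> 1 - \<eta>" using \<gamma>(3)[of n] \<delta> by linarith

text \<open>In twice the combined proximal inequality, the three-point identity creates squared
  distances from the base points, \<open>averaging_contraction\<close> passes to iterates and
  averages, and the two residual bounds absorb the cross terms. The left-hand side is not yet
  \<open>lyap p q (Suc n)\<close>: its gap coefficient is larger, and its averaging coefficients
  still have the old indices. The first discrepancy is \<open>cut\<close>, the second is repaired by
  \<open>weight\<close>.\<close>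

lemma one_step:
  assumes sol: "sol p q" and xn: "x n \<in> G"
  shows "((norm (x (Suc (Suc n)) - p))\<^sup>2 + (1 - \<alpha> (Suc n)) * (norm (xa (Suc (Suc n)) - p))\<^sup>2)
     + ((norm (y (Suc n) - q))\<^sup>2 + (1 - \<gamma> n) * (norm (ya (Suc n) - q))\<^sup>2) / \<beta>
     + 2 * T (Suc n) * (1 + Th (Suc n)) * gap p q (x (Suc n))
     + \<alpha> (Suc n) * (norm (x (Suc n) - xa (Suc (Suc n))))\<^sup>2 + resid n \<le> lyap p q n"
proof -
  define x0 x1 x2 where "x0 = x n" and "x1 = x (Suc n)" and "x2 = x (Suc (Suc n))"
  define y0 y1 where "y0 = y n" and "y1 = y (Suc n)"
  define A0 A1 B where "A0 = x n - xa (Suc n)" and "A1 = x (Suc n) - xa (Suc (Suc n))"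
    and "B = y n - ya (Suc n)"
  define t0 t1 th where "t0 = T n" and "t1 = T (Suc n)" and "th = Th (Suc n)"
  define a0 a1 c where "a0 = \<alpha> n" and "a1 = \<alpha> (Suc n)" and "c = \<gamma> n"
  define d1 d2 e where "d1 = x0 - a0 *\<^sub>R A0 - x1" and "d2 = x1 - a1 *\<^sub>R A1 - x2"
    and "e = y0 - c *\<^sub>R B - y1"
  define p' where "p' = x2 - ex n"
  define q' where "q' = ex n - x1"
  note defs = x0_def x1_def x2_def y0_def y1_def A0_def A1_def B_def t0_def t1_def th_def
    a0_def a1_def c_def
  have t1: "0 < t1" "t1 = th * t0" unfolding defs by (rule T_pos, rule T(2))
  have pq: "p \<in> G" "q \<in> H" using sol by (auto simp: sol_def)
  have "\<beta> * t1 * (hr y1 - hr q) \<le> (e + (\<beta> * t1) *\<^sub>R K (ex n)) \<bullet> (y1 - q)"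
    using y_var[OF pq(2), of n] by (simp add: defs e_def ex_def algebra_simps)
  also have "\<dots> = \<beta> * (e \<bullet> (y1 - q) / \<beta> + t1 * (ex n \<bullet> (Kt y1 - Kt q)))"
    using \<beta> by (simp add: inner_add_left adj linear_diff[OF linear(2)] distrib_left)
  finally have i4: "t1 * (hr y1 - hr q) \<le> e \<bullet> (y1 - q) / \<beta> + t1 * (ex n \<bullet> (Kt y1 - Kt q))"
    using \<beta> by (simp add: mult.assoc)
  have "t1 * ((1 + th) * (gr x1 - gr p + (x1 - p) \<bullet> Kt q) - th * (gr x0 - gr p + (x0 - p) \<bullet> Kt q))
    \<le> d2 \<bullet> (x2 - p) + e \<bullet> (y1 - q) / \<beta> - th * (d1 \<bullet> p') - t1 * ((Kt y1 - Kt y0) \<bullet> p')"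
  proof (rule prox_inequalities_combined)
    show "t1 = th * t0" "0 \<le> th" "0 \<le> t1" using t1 Th(1)[of "Suc n"] by (auto simp: th_def)
    show "t1 * (gr x2 - gr p) \<le> (d2 - t1 *\<^sub>R Kt y1) \<bullet> (x2 - p)"
      using x_var[OF pq(1), of "Suc n"] by (simp add: defs d2_def algebra_simps)
    show "t0 * (gr x1 - gr x2) \<le> (d1 - t0 *\<^sub>R Kt y0) \<bullet> (x1 - x2)"
      using x_var[OF x_mem, of n "Suc n"] by (simp add: defs d1_def algebra_simps)
    show "t0 * (gr x1 - gr x0) \<le> (d1 - t0 *\<^sub>R Kt y0) \<bullet> (x1 - x0)"
      using x_var[OF xn, of n] by (simp add: defs d1_def algebra_simps)
    show "t1 * (hr y1 - hr q) \<le> e \<bullet> (y1 - q) / \<beta> + t1 * ((x1 + th *\<^sub>R (x1 - x0)) \<bullet> (Kt y1 - Kt q))"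
      using i4 by (simp add: ex_def defs)
    show "hr q - p \<bullet> Kt q \<le> hr y1 - p \<bullet> Kt y1"
      using sol y_mem[of n] by (auto simp: sol_def adj y1_def)
    show "p' = x2 - (x1 + th *\<^sub>R (x1 - x0))" by (simp add: p'_def ex_def defs)
  qed
  then have c1: "t1 * ((1 + th) * gap p q x1 - th * gap p q x0)
    \<le> d2 \<bullet> (x2 - p) + e \<bullet> (y1 - q) / \<beta> - th * (d1 \<bullet> p') - t1 * ((Kt y1 - Kt y0) \<bullet> p')"
    by (simp add: gap_def)
  have c2: "th *\<^sub>R d1 = - (q' + (th * a0) *\<^sub>R A0)"
    by (simp add: d1_def q'_def ex_def defs algebra_simps)
  \<comment> \<open>The one bilinear term left over is bounded by the linesearch criterion. Dividing
    the dual increment by \<open>sqrt \<beta>\<close> before the product is split gives it the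
    weight \<open>1 / \<beta>\<close> that dual distances have in \<open>lyap\<close>.\<close>
  have c3: "- 2 * (t1 * ((Kt y1 - Kt y0) \<bullet> p')) \<le> \<delta> / \<beta> * (norm (y1 - y0))\<^sup>2 + \<delta> * (norm p')\<^sup>2"
  proof -
    have "sqrt \<beta> * (t1 * norm (Kt y1 - Kt y0)) \<le> \<delta> * norm (y1 - y0)"
      using linesearch[of n] by (simp add: defs mult.assoc)
    then have l: "t1 * norm (Kt y1 - Kt y0) \<le> \<delta> * (norm (y1 - y0) / sqrt \<beta>)"
      using \<beta> by (simp add: field_simps)
    have "- ((Kt y1 - Kt y0) \<bullet> p') \<le> norm (Kt y1 - Kt y0) * norm p'"
      using Cauchy_Schwarz_ineq2[of "Kt y1 - Kt y0" p'] by linarith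
    then have "t1 * (- ((Kt y1 - Kt y0) \<bullet> p')) \<le> t1 * (norm (Kt y1 - Kt y0) * norm p')"
      using t1(1) by (intro mult_left_mono) auto
    also have "\<dots> \<le> (\<delta> * (norm (y1 - y0) / sqrt \<beta>)) * norm p'"
      using mult_right_mono[OF l, of "norm p'"] by (simp only: mult.assoc norm_ge_zero)
    finally have "- 2 * (t1 * ((Kt y1 - Kt y0) \<bullet> p')) \<le> 2 * (\<delta> * (norm (y1 - y0) / sqrt \<beta>) * norm p')"
      by linarith
    also have "\<dots> = \<delta> * (2 * (norm (y1 - y0) / sqrt \<beta>) * norm p')" by (simp only: mult_ac)
    also have "\<dots> \<le> \<delta> * ((norm (y1 - y0) / sqrt \<beta>)\<^sup>2 + (norm p')\<^sup>2)"
      using \<delta> by (intro mult_left_mono sum_squares_bound) auto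
    finally show ?thesis using \<beta> by (simp add: power_divide distrib_left)
  qed
  have c4: "2 * (d2 \<bullet> (x2 - p)) = (norm (x1 - a1 *\<^sub>R A1 - p))\<^sup>2 - (norm (x2 - p))\<^sup>2
      - (norm (p' + q' + a1 *\<^sub>R A1))\<^sup>2"
  proof -
    have "p' + q' + a1 *\<^sub>R A1 = (x2 - p) - (x1 - a1 *\<^sub>R A1 - p)" by (simp add: p'_def q'_def)
    moreover have "d2 = (x1 - a1 *\<^sub>R A1 - p) - (x2 - p)" by (simp add: d2_def)
    ultimately show ?thesis
      by (simp only: power2_norm_eq_inner) (simp add: inner_diff_left inner_diff_right inner_commute algebra_simps)
  qed
  have c5: "2 * (e \<bullet> (y1 - q)) = (norm (y0 - c *\<^sub>R B - q))\<^sup>2 - (norm (y1 - q))\<^sup>2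
      - (norm ((y1 - y0) + c *\<^sub>R B))\<^sup>2"
  proof -
    have "(y1 - y0) + c *\<^sub>R B = (y1 - q) - (y0 - c *\<^sub>R B - q)" by simp
    moreover have "e = (y0 - c *\<^sub>R B - q) - (y1 - q)" by (simp add: e_def)
    ultimately show ?thesis
      by (simp only: power2_norm_eq_inner) (simp add: inner_diff_left inner_diff_right inner_commute algebra_simps)
  qed
  have c6: "(norm (x1 - a1 *\<^sub>R A1 - p))\<^sup>2 + (1 - a1) * (norm (xa (Suc (Suc n)) - p))\<^sup>2 + 2 * a1 * (norm A1)\<^sup>2
    \<le> (norm (x1 - p))\<^sup>2 + (1 - a1) * (norm (xa (Suc n) - p))\<^sup>2"
    unfolding defs by (rule averaging_contraction) (use \<alpha>(1)[of "Suc n"] \<alpha>_le[of "Suc n"] \<eta> xa_Suc in auto)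
  have c7: "(norm (y0 - c *\<^sub>R B - q))\<^sup>2 + (1 - c) * (norm (ya (Suc n) - q))\<^sup>2 + 2 * c * (norm B)\<^sup>2
    \<le> (norm (y0 - q))\<^sup>2 + (1 - c) * (norm (ya n - q))\<^sup>2"
    unfolding defs by (rule averaging_contraction) (use \<gamma>(1)[of n] \<gamma>_le[of n] \<eta> ya_Suc in auto)
  have c8: "- (norm (p' + q' + a1 *\<^sub>R A1))\<^sup>2 + 2 * ((q' + (th * a0) *\<^sub>R A0) \<bullet> p') + \<delta> * (norm p')\<^sup>2
      - 2 * a1 * (norm A1)\<^sup>2
    \<le> a0 * (norm A0)\<^sup>2 - a1 * (norm A1)\<^sup>2
      - (\<eta>/2 * (norm p')\<^sup>2 + (1 - 1 / (1 + \<eta>/2/2)) * (norm q')\<^sup>2 + \<eta>/2 / 2 * (a1 * (norm A1)\<^sup>2))"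
    by (rule primal_residual_bound[where \<theta>=\<theta>])
      (use \<alpha>(1,2)[of n] \<alpha>(1)[of "Suc n"] \<alpha>(3)[of n] \<eta> \<delta> Th(2)[of "Suc n"] Th_nonneg in \<open>auto simp: defs\<close>)
  have c9: "- (norm ((y1 - y0) + c *\<^sub>R B))\<^sup>2 + \<delta> * (norm (y1 - y0))\<^sup>2 - 2 * c * (norm B)\<^sup>2
    \<le> - (\<eta> * (norm (y1 - y0))\<^sup>2 + c * (norm B)\<^sup>2)"
    by (rule dual_residual_bound) (use \<gamma>(1,3)[of n] in \<open>auto simp: defs\<close>)
  have "2 * (e \<bullet> (y1 - q)) + \<delta> * (norm (y1 - y0))\<^sup>2
      + (norm (y1 - q))\<^sup>2 + (1 - c) * (norm (ya (Suc n) - q))\<^sup>2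
      + (\<eta> * (norm (y1 - y0))\<^sup>2 + c * (norm B)\<^sup>2)
    \<le> (norm (y0 - q))\<^sup>2 + (1 - c) * (norm (ya n - q))\<^sup>2"
    using c5 c7 c9 by linarith
  then have "(2 * (e \<bullet> (y1 - q)) + \<delta> * (norm (y1 - y0))\<^sup>2
      + (norm (y1 - q))\<^sup>2 + (1 - c) * (norm (ya (Suc n) - q))\<^sup>2
      + (\<eta> * (norm (y1 - y0))\<^sup>2 + c * (norm B)\<^sup>2)) / \<beta>
    \<le> ((norm (y0 - q))\<^sup>2 + (1 - c) * (norm (ya n - q))\<^sup>2) / \<beta>"
    using \<beta> by (intro divide_right_mono) auto
  then have dual: "2 * (e \<bullet> (y1 - q) / \<beta>) + \<delta> / \<beta> * (norm (y1 - y0))\<^sup>2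
      + ((norm (y1 - q))\<^sup>2 + (1 - c) * (norm (ya (Suc n) - q))\<^sup>2) / \<beta>
      + (\<eta> * (norm (y1 - y0))\<^sup>2 + c * (norm B)\<^sup>2) / \<beta>
    \<le> ((norm (y0 - q))\<^sup>2 + (1 - c) * (norm (ya n - q))\<^sup>2) / \<beta>"
    by (simp add: add_divide_distrib)
  have c10: "- (th * (d1 \<bullet> p')) = (q' + (th * a0) *\<^sub>R A0) \<bullet> p'"
    using arg_cong[OF c2, of "\<lambda>z. z \<bullet> p'"] by (simp add: inner_add_left inner_diff_left)
  have c11: "2 * (t1 * ((1 + th) * gap p q x1 - th * gap p q x0)) =
      2 * t1 * (1 + th) * gap p q x1 - 2 * t1 * th * gap p q x0"
    by (simp add: algebra_simps)
  show ?thesis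
    using c1 c3 c4 c6 c8 c10 c11 dual
    unfolding lyap_def resid_def p'_def q'_def defs by linarith
qed

text \<open>The surplus of the gap coefficient produced by one step over the one charged by the
  next. It vanishes when \<open>Th (Suc (Suc n)) = sqrt (1 + Th (Suc n))\<close>, that is, when the
  first trial of the linesearch is accepted.\<close>

definition cut :: "'a \<Rightarrow> 'b \<Rightarrow> nat \<Rightarrow> real" where
  "cut p q n = 2 * (T (Suc n) * (1 + Th (Suc n)) - T (Suc (Suc n)) * Th (Suc (Suc n)))
     * gap p q (x (Suc n))"

text \<open>A product of both averaging coefficients, since both grow: dividing either coefficient
  of \<open>lyap\<close> by it leaves the reciprocal of the other one, which is non-increasing, and
  so is \<open>1 / weight n\<close>.\<close>

definition weight :: "nat \<Rightarrow> real" where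
  "weight n = (1 - \<alpha> (Suc n)) * (1 - \<gamma> n)"

lemma one_minus_pos: "0 < 1 - \<alpha> n" "0 < 1 - \<gamma> n"
  using \<alpha>_le[of n] \<gamma>_le[of n] \<eta> by linarith+

lemma weight_bounds: "0 < weight n" "weight n \<le> 1" "weight n \<le> weight (Suc n)"
proof -
  show "0 < weight n" using one_minus_pos by (simp add: weight_def)
  have "(1 - \<alpha> (Suc n)) * (1 - \<gamma> n) \<le> 1 * 1"
    using one_minus_pos[of n] one_minus_pos[of "Suc n"] \<alpha>(1)[of "Suc n"] \<gamma>(1)[of n]
    by (intro mult_mono) auto
  then show "weight n \<le> 1" by (simp add: weight_def)
  show "weight n \<le> weight (Suc n)" unfolding weight_def
    using one_minus_pos[of n] one_minus_pos[of "Suc (Suc n)"] \<alpha>(2)[of "Suc n"] \<gamma>(2)[of n]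
    by (intro mult_mono) auto
qed

lemma convergent_\<alpha>: "convergent \<alpha>"
proof -
  have "decseq \<alpha>" using \<alpha>(2) by (rule decseq_SucI)
  then obtain L where "\<alpha> \<longlonglongrightarrow> L"
    using decseq_convergent[of \<alpha> 0] \<alpha>(1) less_imp_le by metis
  then show ?thesis by (auto simp: convergent_def)
qed

lemma convergent_\<gamma>: "convergent \<gamma>"
proof -
  have "decseq \<gamma>" using \<gamma>(2) by (rule decseq_SucI)
  then obtain L where "\<gamma> \<longlonglongrightarrow> L"
    using decseq_convergent[of \<gamma> 0] \<gamma>(1) less_imp_le by metis
  then show ?thesis by (auto simp: convergent_def)
qed

lemma T_Th_Suc: "T (Suc n) * Th (Suc n) = T n * (Th (Suc n))\<^sup>2"
  by (simp add: T(2) power2_eq_square)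

lemma T_Th_le: "T (Suc n) * Th (Suc n) \<le> T n * (1 + Th n)"
proof -
  have "\<mu> * sqrt (1 + Th n) \<le> 1 * sqrt (1 + Th n)"
    using \<mu> Th_nonneg[of n] by (intro mult_right_mono) auto
  then have "Th (Suc n) \<le> sqrt (1 + Th n)" using Th_step[of n] by linarith
  then have "(Th (Suc n))\<^sup>2 \<le> (sqrt (1 + Th n))\<^sup>2" using Th_nonneg by (rule power_mono)
  then have "(Th (Suc n))\<^sup>2 \<le> 1 + Th n" using Th_nonneg[of n] by simp
  then show ?thesis unfolding T_Th_Suc using T_pos[of n] by (intro mult_left_mono) auto
qed

lemma cut_nonneg: "sol p q \<Longrightarrow> 0 \<le> cut p q n"
  unfolding cut_def using T_Th_le[of "Suc n"] gap_nonneg[OF _ x_mem, of p q n] by simp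

lemma resid_nonneg: "0 \<le> resid n"
  unfolding resid_def using \<eta> \<beta> \<alpha>(1)[of "Suc n"] \<gamma>(1)[of n]
  by (intro add_nonneg_nonneg mult_nonneg_nonneg divide_nonneg_nonneg) auto

lemma lyap_nonneg:
  assumes "sol p q" "x n \<in> G" shows "0 \<le> lyap p q n"
  unfolding lyap_def using one_minus_pos[of n] one_minus_pos[of "Suc n"] \<beta> T_pos[of "Suc n"]
    Th_nonneg[of "Suc n"] \<alpha>(1)[of n] gap_nonneg[OF assms]
  by (intro add_nonneg_nonneg mult_nonneg_nonneg divide_nonneg_nonneg) auto

text \<open>The weights of the averaged iterates grow with the index, so that the Lyapunov function itself
  need not decrease; normalising by \<^term>\<open>weight\<close> makes it monotone.\<close>

lemma lyap_step:
  assumes sol: "sol p q" and xn: "x n \<in> G"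
  shows "lyap p q (Suc n) / weight (Suc n) + (resid n + cut p q n) \<le> lyap p q n / weight n"
proof -
  define V W Vy Wy where "V = (norm (x (Suc (Suc n)) - p))\<^sup>2" and "W = (norm (xa (Suc (Suc n)) - p))\<^sup>2"
    and "Vy = (norm (y (Suc n) - q))\<^sup>2" and "Wy = (norm (ya (Suc n) - q))\<^sup>2"
  define R where "R = 2 * T (Suc (Suc n)) * Th (Suc (Suc n)) * gap p q (x (Suc n))
     + \<alpha> (Suc n) * (norm (x (Suc n) - xa (Suc (Suc n))))\<^sup>2"
  define S where "S = (V + (1 - \<alpha> (Suc n)) * W) + (Vy + (1 - \<gamma> n) * Wy) / \<beta> + R"
  have R: "0 \<le> R" unfolding R_def
    using T_pos[of "Suc (Suc n)"] Th_nonneg[of "Suc (Suc n)"] \<alpha>(1)[of "Suc n"] gap_nonneg[OF sol x_mem[of n]]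
    by (intro add_nonneg_nonneg mult_nonneg_nonneg) auto
  have nn: "0 \<le> V" "0 \<le> W" "0 \<le> Vy" "0 \<le> Wy" by (simp_all add: V_def W_def Vy_def Wy_def)
  have 1: "S + resid n + cut p q n \<le> lyap p q n"
    using one_step[OF assms] unfolding S_def R_def V_def W_def Vy_def Wy_def cut_def
    by (simp add: algebra_simps)
  have l: "lyap p q (Suc n) = (V + (1 - \<alpha> (Suc (Suc n))) * W) + (Vy + (1 - \<gamma> (Suc n)) * Wy) / \<beta> + R"
    unfolding lyap_def R_def V_def W_def Vy_def Wy_def by simp
  note w = weight_bounds[of n] weight_bounds[of "Suc n"]
  have "weight n * (1 - \<alpha> (Suc (Suc n))) \<le> weight (Suc n) * (1 - \<alpha> (Suc n))"
  proof -
    have "(1 - \<alpha> (Suc n)) * (1 - \<alpha> (Suc (Suc n))) * (1 - \<gamma> n)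
        \<le> (1 - \<alpha> (Suc n)) * (1 - \<alpha> (Suc (Suc n))) * (1 - \<gamma> (Suc n))"
      using one_minus_pos \<gamma>(2)[of n] by (intro mult_left_mono) (auto simp: less_imp_le)
    then show ?thesis by (simp add: weight_def mult_ac)
  qed
  from mult_right_mono[OF this nn(2)]
  have aW: "weight n * ((1 - \<alpha> (Suc (Suc n))) * W) \<le> weight (Suc n) * ((1 - \<alpha> (Suc n)) * W)"
    by (simp add: mult.assoc)
  have "weight n * (1 - \<gamma> (Suc n)) \<le> weight (Suc n) * (1 - \<gamma> n)"
  proof -
    have "(1 - \<gamma> n) * (1 - \<gamma> (Suc n)) * (1 - \<alpha> (Suc n))
        \<le> (1 - \<gamma> n) * (1 - \<gamma> (Suc n)) * (1 - \<alpha> (Suc (Suc n)))"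
      using one_minus_pos \<alpha>(2)[of "Suc n"] by (intro mult_left_mono) (auto simp: less_imp_le)
    then show ?thesis by (simp add: weight_def mult_ac)
  qed
  from mult_right_mono[OF this nn(4)]
  have gW: "weight n * ((1 - \<gamma> (Suc n)) * Wy) \<le> weight (Suc n) * ((1 - \<gamma> n) * Wy)"
    by (simp add: mult.assoc)
  have Ve: "weight n * V \<le> weight (Suc n) * V" "weight n * Vy \<le> weight (Suc n) * Vy"
    "weight n * R \<le> weight (Suc n) * R"
    using w(3) nn R by (auto intro: mult_right_mono)
  have "weight n * (Vy + (1 - \<gamma> (Suc n)) * Wy) \<le> weight (Suc n) * (Vy + (1 - \<gamma> n) * Wy)"
    using gW Ve by (simp only: distrib_left add_mono)
  then have "weight n * (Vy + (1 - \<gamma> (Suc n)) * Wy) / \<beta> \<le> weight (Suc n) * (Vy + (1 - \<gamma> n) * Wy) / \<beta>"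
    using \<beta> by (intro divide_right_mono) auto
  then have "weight n * lyap p q (Suc n) \<le> weight (Suc n) * S"
    using aW Ve unfolding l S_def by (simp only: distrib_left times_divide_eq_right)
  then have "lyap p q (Suc n) / weight (Suc n) \<le> S / weight n"
    using w by (simp add: field_simps)
  moreover have "S / weight n \<le> (lyap p q n - (resid n + cut p q n)) / weight n"
    using 1 w(1) by (intro divide_right_mono) auto
  moreover have "resid n + cut p q n \<le> (resid n + cut p q n) / weight n"
  proof -
    have nn: "0 \<le> resid n + cut p q n" using resid_nonneg cut_nonneg[OF sol] by (simp add: add_nonneg_nonneg)
    have "(resid n + cut p q n) * weight n \<le> (resid n + cut p q n) * 1"
      using w(2) nn by (rule mult_left_mono)
    then show ?thesis using w(1) by (simp add: pos_le_divide_eq)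
  qed
  ultimately show ?thesis by (simp add: diff_divide_distrib)
qed

lemma
  assumes sol: "sol p q"
  shows convergent_lyap: "convergent (lyap p q)"
    and resid_tendsto: "resid \<longlonglongrightarrow> 0"
    and cut_tendsto: "cut p q \<longlonglongrightarrow> 0"
proof -
  \<comment> \<open>The shift by one guarantees membership in \<open>G\<close>, where the gap is
    nonnegative: \<open>x_mem\<close> covers the iterates from index 1 on, while the starting point
    may be arbitrary.\<close>
  let ?M = "\<lambda>n. lyap p q (Suc n) / weight (Suc n)"
  let ?r = "\<lambda>n. resid (Suc n) + cut p q (Suc n)"
  have r: "0 \<le> ?r n" for n using resid_nonneg cut_nonneg[OF sol] by (simp add: add_nonneg_nonneg)
  have M: "0 \<le> ?M n" for n
    using lyap_nonneg[OF sol x_mem] weight_bounds(1)[of "Suc n"] by simp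
  note tel = antimono_telescoping[of ?r ?M, OF r M lyap_step[OF sol x_mem]]
  obtain L where L: "?M \<longlonglongrightarrow> L" using tel(1) by (auto simp: convergent_def)
  obtain a c where ac: "\<alpha> \<longlonglongrightarrow> a" "\<gamma> \<longlonglongrightarrow> c"
    using convergent_\<alpha> convergent_\<gamma> by (auto simp: convergent_def)
  \<comment> \<open>The weights converge, so multiplying them back transfers convergence from the
    normalised sequence to \<open>lyap\<close>.\<close>
  have "(\<lambda>n. ?M n * weight (Suc n)) \<longlonglongrightarrow> L * ((1 - a) * (1 - c))"
    unfolding weight_def
    by (intro tendsto_intros L[unfolded weight_def] LIMSEQ_Suc ac)
  moreover have "?M n * weight (Suc n) = lyap p q (Suc n)" for n
    using weight_bounds(1)[of "Suc n"] by simp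
  ultimately have "(\<lambda>n. lyap p q (Suc n)) \<longlonglongrightarrow> L * ((1 - a) * (1 - c))" by simp
  then show "convergent (lyap p q)" using LIMSEQ_imp_Suc by (auto simp: convergent_def)
  have "(\<lambda>n. resid (Suc n)) \<longlonglongrightarrow> 0"
    by (rule tendsto_sandwich[OF _ _ tendsto_const tel(2)])
       (use resid_nonneg cut_nonneg[OF sol] in auto)
  then show "resid \<longlonglongrightarrow> 0" by (rule LIMSEQ_imp_Suc)
  have "(\<lambda>n. cut p q (Suc n)) \<longlonglongrightarrow> 0"
    by (rule tendsto_sandwich[OF _ _ tendsto_const tel(2)])
       (use resid_nonneg cut_nonneg[OF sol] in auto)
  then show "cut p q \<longlonglongrightarrow> 0" by (rule LIMSEQ_imp_Suc)
qed

section \<open>Vanishing residuals and boundedness\<close>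

lemma resid_term_tendsto:
  assumes sol: "sol p q" and "c > 0" "\<And>n. 0 \<le> f n" "\<And>n. c * f n \<le> resid n"
  shows "f \<longlonglongrightarrow> 0"
proof -
  have "(\<lambda>n. resid n / c) \<longlonglongrightarrow> 0 / c" by (intro tendsto_intros resid_tendsto[OF sol]) (use assms in auto)
  then have "(\<lambda>n. resid n / c) \<longlonglongrightarrow> 0" by simp
  then show ?thesis
    by (rule tendsto_sandwich[OF _ _ tendsto_const, rotated 2])
      (use assms in \<open>auto simp: field_simps\<close>)
qed

lemma resid_ge:
  "\<eta>/2 * (norm (x (Suc (Suc n)) - ex n))\<^sup>2 \<le> resid n"
  "(1 - 1 / (1 + \<eta>/2/2)) * (norm (ex n - x (Suc n)))\<^sup>2 \<le> resid n"
  "\<eta>/2/2 * (\<alpha> (Suc n) * (norm (x (Suc n) - xa (Suc (Suc n))))\<^sup>2) \<le> resid n"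
  "\<eta> / \<beta> * (norm (y (Suc n) - y n))\<^sup>2 \<le> resid n"
  "1 / \<beta> * (\<gamma> n * (norm (y n - ya (Suc n)))\<^sup>2) \<le> resid n"
proof -
  define A B C D E where "A = \<eta>/2 * (norm (x (Suc (Suc n)) - ex n))\<^sup>2"
    and "B = (1 - 1 / (1 + \<eta>/2/2)) * (norm (ex n - x (Suc n)))\<^sup>2"
    and "C = \<eta>/2/2 * (\<alpha> (Suc n) * (norm (x (Suc n) - xa (Suc (Suc n))))\<^sup>2)"
    and "D = \<eta> / \<beta> * (norm (y (Suc n) - y n))\<^sup>2"
    and "E = 1 / \<beta> * (\<gamma> n * (norm (y n - ya (Suc n)))\<^sup>2)"
  have "resid n = A + B + C + D + E"
    unfolding resid_def A_def B_def C_def D_def E_def by (simp add: add_divide_distrib)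
  moreover have "0 \<le> A" "0 \<le> B" "0 \<le> C" "0 \<le> D" "0 \<le> E"
    unfolding A_def B_def C_def D_def E_def
    using \<eta> \<beta> \<alpha>(1)[of "Suc n"] \<gamma>(1)[of n] by simp_all
  ultimately show
    "\<eta>/2 * (norm (x (Suc (Suc n)) - ex n))\<^sup>2 \<le> resid n"
    "(1 - 1 / (1 + \<eta>/2/2)) * (norm (ex n - x (Suc n)))\<^sup>2 \<le> resid n"
    "\<eta>/2/2 * (\<alpha> (Suc n) * (norm (x (Suc n) - xa (Suc (Suc n))))\<^sup>2) \<le> resid n"
    "\<eta> / \<beta> * (norm (y (Suc n) - y n))\<^sup>2 \<le> resid n"
    "1 / \<beta> * (\<gamma> n * (norm (y n - ya (Suc n)))\<^sup>2) \<le> resid n"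
    unfolding A_def[symmetric] B_def[symmetric] C_def[symmetric] D_def[symmetric] E_def[symmetric]
    by linarith+
qed

lemma norm_sq_tendsto_0: "(\<lambda>n. (norm (f n))\<^sup>2) \<longlonglongrightarrow> 0 \<Longrightarrow> f \<longlonglongrightarrow> 0"
  for f :: "nat \<Rightarrow> 'c::real_normed_vector"
  using tendsto_real_sqrt[of "\<lambda>n. (norm (f n))\<^sup>2" 0 sequentially]
  by (simp add: tendsto_norm_zero_iff)

text \<open>When the coefficients tend to 0, \<open>f\<close> itself may stay away from 0; the
  scaled vectors still vanish because \<open>(c n)\<^sup>2 \<le> c n\<close>. Exactly such scaled
  vectors, the averaging displacements, occur in the proximal inequalities.\<close>

lemma scaled_tendsto_0:
  fixes f :: "nat \<Rightarrow> 'c::real_normed_vector"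
  assumes "(\<lambda>n. c n * (norm (f n))\<^sup>2) \<longlonglongrightarrow> 0" "\<And>n. 0 \<le> c n" "\<And>n. c n \<le> 1"
  shows "(\<lambda>n. c n *\<^sub>R f n) \<longlonglongrightarrow> 0"
proof (rule norm_sq_tendsto_0, rule tendsto_sandwich[OF _ _ tendsto_const assms(1)])
  have "c n * c n \<le> c n * 1" for n using assms(2,3)[of n] by (intro mult_left_mono) auto
  then have "(c n)\<^sup>2 * (norm (f n))\<^sup>2 \<le> c n * (norm (f n))\<^sup>2" for n
    by (intro mult_right_mono) (auto simp: power2_eq_square)
  then show "\<forall>\<^sub>F n in sequentially. (norm (c n *\<^sub>R f n))\<^sup>2 \<le> c n * (norm (f n))\<^sup>2"
    using assms(2) by (intro always_eventually allI) (simp add: power_mult_distrib)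
qed simp

lemma
  assumes sol: "sol p q"
  shows ex_diff: "(\<lambda>n. x (Suc (Suc n)) - ex n) \<longlonglongrightarrow> 0"
    and x_diff: "(\<lambda>n. x (Suc n) - x n) \<longlonglongrightarrow> 0"
    and y_diff: "(\<lambda>n. y (Suc n) - y n) \<longlonglongrightarrow> 0"
    and \<alpha>_sq: "(\<lambda>n. \<alpha> n * (norm (x n - xa (Suc n)))\<^sup>2) \<longlonglongrightarrow> 0"
    and \<alpha>_diff: "(\<lambda>n. \<alpha> n *\<^sub>R (x n - xa (Suc n))) \<longlonglongrightarrow> 0"
    and \<gamma>_diff: "(\<lambda>n. \<gamma> n *\<^sub>R (y n - ya (Suc n))) \<longlonglongrightarrow> 0"
proof -
  show 1: "(\<lambda>n. x (Suc (Suc n)) - ex n) \<longlonglongrightarrow> 0"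
    by (rule norm_sq_tendsto_0, rule resid_term_tendsto[OF sol _ _ resid_ge(1)]) (use \<eta> in auto)
  have 2: "(\<lambda>n. ex n - x (Suc n)) \<longlonglongrightarrow> 0"
    by (rule norm_sq_tendsto_0, rule resid_term_tendsto[OF sol _ _ resid_ge(2)]) (use \<eta> in auto)
  have "(\<lambda>n. x (Suc (Suc n)) - x (Suc n)) \<longlonglongrightarrow> 0" using tendsto_add[OF 1 2] by simp
  then show "(\<lambda>n. x (Suc n) - x n) \<longlonglongrightarrow> 0" by (rule LIMSEQ_imp_Suc)
  show "(\<lambda>n. y (Suc n) - y n) \<longlonglongrightarrow> 0"
    by (rule norm_sq_tendsto_0, rule resid_term_tendsto[OF sol _ _ resid_ge(4)]) (use \<eta> \<beta> in auto)
  have "(\<lambda>n. \<alpha> (Suc n) * (norm (x (Suc n) - xa (Suc (Suc n))))\<^sup>2) \<longlonglongrightarrow> 0"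
    by (rule resid_term_tendsto[OF sol _ _ resid_ge(3)]) (use \<eta> \<alpha>(1) in \<open>auto simp: less_imp_le\<close>)
  then show 3: "(\<lambda>n. \<alpha> n * (norm (x n - xa (Suc n)))\<^sup>2) \<longlonglongrightarrow> 0"
    by (rule LIMSEQ_imp_Suc)
  show "(\<lambda>n. \<alpha> n *\<^sub>R (x n - xa (Suc n))) \<longlonglongrightarrow> 0"
    by (rule scaled_tendsto_0[OF 3]) (use \<alpha>(1) one_minus_pos less_imp_le in \<open>auto simp: less_imp_le\<close>)
  have 4: "(\<lambda>n. \<gamma> n * (norm (y n - ya (Suc n)))\<^sup>2) \<longlonglongrightarrow> 0"
    by (rule resid_term_tendsto[OF sol _ _ resid_ge(5)]) (use \<beta> \<gamma>(1) in \<open>auto simp: less_imp_le\<close>)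
  show "(\<lambda>n. \<gamma> n *\<^sub>R (y n - ya (Suc n))) \<longlonglongrightarrow> 0"
    by (rule scaled_tendsto_0[OF 4]) (use \<gamma>(1) one_minus_pos less_imp_le in \<open>auto simp: less_imp_le\<close>)
qed

lemma bounded_range_Suc:
  fixes f :: "nat \<Rightarrow> 'c::metric_space"
  assumes "bounded (range (\<lambda>n. f (Suc n)))"
  shows "bounded (range f)"
proof -
  have "range f \<subseteq> insert (f 0) (range (\<lambda>n. f (Suc n)))"
    by (auto simp: image_iff) (metis not0_implies_Suc)
  then show ?thesis using assms by (meson bounded_insert bounded_subset)
qed

lemma bounded_of_sq_bound:
  fixes f :: "nat \<Rightarrow> 'c::real_normed_vector"
  assumes "c > 0" "\<And>n. c * (norm (f (Suc n) - p))\<^sup>2 \<le> C"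
  shows "bounded (range f)"
proof (rule bounded_range_Suc)
  have "norm (f (Suc n)) \<le> norm p + sqrt (C / c)" for n
  proof -
    have "(norm (f (Suc n) - p))\<^sup>2 \<le> C / c" using assms by (simp add: field_simps)
    then have "norm (f (Suc n) - p) \<le> sqrt (C / c)" by (rule real_le_rsqrt)
    then show ?thesis using norm_triangle_ineq[of p "f (Suc n) - p"] by simp
  qed
  then show "bounded (range (\<lambda>n. f (Suc n)))" by (auto simp: bounded_iff)
qed

lemma
  assumes sol: "sol p q"
  shows bounded_x: "bounded (range x)" and bounded_xa: "bounded (range xa)"
    and bounded_y: "bounded (range y)" and bounded_ya: "bounded (range ya)"
proof -
  have "Bseq (lyap p q)" using convergent_lyap[OF sol] by (rule convergent_imp_Bseq)
  then obtain C where C: "\<And>n. lyap p q n \<le> C" by (auto simp: Bseq_def abs_le_iff)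
  have parts: "(norm (x (Suc (Suc n)) - p))\<^sup>2 \<le> C \<and> \<eta> * (norm (xa (Suc (Suc n)) - p))\<^sup>2 \<le> C \<and>
    1 / \<beta> * (norm (y (Suc n) - q))\<^sup>2 \<le> C \<and> \<eta> / \<beta> * (norm (ya (Suc n) - q))\<^sup>2 \<le> C" for n
  proof -
    define a b c d e where "a = (norm (x (Suc (Suc n)) - p))\<^sup>2"
      and "b = (1 - \<alpha> (Suc (Suc n))) * (norm (xa (Suc (Suc n)) - p))\<^sup>2"
      and "c = 1 / \<beta> * (norm (y (Suc n) - q))\<^sup>2"
      and "d = (1 - \<gamma> (Suc n)) / \<beta> * (norm (ya (Suc n) - q))\<^sup>2"
      and "e = 2 * T (Suc (Suc n)) * Th (Suc (Suc n)) * gap p q (x (Suc n))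
        + \<alpha> (Suc n) * (norm (x (Suc n) - xa (Suc (Suc n))))\<^sup>2"
    have "lyap p q (Suc n) = a + b + c + d + e"
      unfolding lyap_def a_def b_def c_def d_def e_def by (simp add: add_divide_distrib)
    moreover have "0 \<le> a" "0 \<le> b" "0 \<le> c" "0 \<le> d"
      unfolding a_def b_def c_def d_def
      using one_minus_pos(1)[of "Suc (Suc n)"] one_minus_pos(2)[of "Suc n"] \<beta> by simp_all
    moreover have "0 \<le> e" unfolding e_def
      using T_pos[of "Suc (Suc n)"] Th_nonneg[of "Suc (Suc n)"] \<alpha>(1)[of "Suc n"] gap_nonneg[OF sol x_mem[of n]]
      by (intro add_nonneg_nonneg mult_nonneg_nonneg) auto
    moreover have "\<eta> * (norm (xa (Suc (Suc n)) - p))\<^sup>2 \<le> b"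
      unfolding b_def using \<alpha>_le[of "Suc (Suc n)"] by (intro mult_right_mono) auto
    moreover have "\<eta> / \<beta> * (norm (ya (Suc n) - q))\<^sup>2 \<le> d"
      unfolding d_def using \<gamma>_le[of "Suc n"] \<beta> by (intro mult_right_mono divide_right_mono) auto
    ultimately show ?thesis using C[of "Suc n"] unfolding a_def[symmetric] c_def[symmetric] by linarith
  qed
  show "bounded (range x)"
    by (rule bounded_range_Suc, rule bounded_of_sq_bound[of 1 _ p C]) (use parts in auto)
  show "bounded (range xa)"
    by (rule bounded_range_Suc, rule bounded_of_sq_bound[of \<eta> _ p C]) (use parts \<eta> in auto)
  show "bounded (range y)"
    by (rule bounded_of_sq_bound[of "1/\<beta>" _ q C]) (use parts \<beta> in auto)
  show "bounded (range ya)"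
    by (rule bounded_of_sq_bound[of "\<eta>/\<beta>" _ q C]) (use parts \<eta> \<beta> in auto)
qed

section \<open>Cluster points and convergence of the primal iterates\<close>

lemma divide_T_tendsto_0:
  fixes f :: "nat \<Rightarrow> real"
  assumes "f \<longlonglongrightarrow> 0"
  shows "(\<lambda>n. f n / T (r n)) \<longlonglongrightarrow> 0"
proof (rule tendsto_rabs_zero_cancel, rule tendsto_sandwich[OF _ _ tendsto_const])
  have "(\<lambda>n. \<bar>f n\<bar> / tmin) \<longlonglongrightarrow> 0 / tmin"
    by (intro tendsto_intros tendsto_rabs_zero assms) (use tmin in auto)
  then show "(\<lambda>n. \<bar>f n\<bar> / tmin) \<longlonglongrightarrow> 0" by simp
  have "\<bar>f n / T (r n)\<bar> \<le> \<bar>f n\<bar> / tmin" for n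
    using T(1)[of "r n"] T_pos[of "r n"] tmin by (simp add: abs_div frac_le)
  then show "\<forall>\<^sub>F n in sequentially. \<bar>f n / T (r n)\<bar> \<le> \<bar>f n\<bar> / tmin" by simp
qed simp

text \<open>The proximal inequalities are divided by the step size before passing to the limit. The
  lower bound \<open>tmin\<close> then makes the error terms vanish even if the step sizes are
  unbounded, and \<open>G_lim\<close> and \<open>H_lim\<close> provide the lower semicontinuity for
  the function values.\<close>

lemma cluster_sol:
  assumes sol: "sol p0 q0" and r: "strict_mono (r :: nat \<Rightarrow> nat)"
    and xr: "(x \<circ> r) \<longlonglongrightarrow> p" and yr: "(y \<circ> r) \<longlonglongrightarrow> q"
  shows "sol p q"
proof -
  have subb: "(\<lambda>n. f (r n)) \<longlonglongrightarrow> l" if "f \<longlonglongrightarrow> l" for f :: "nat \<Rightarrow> 'b" and l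
    using LIMSEQ_subseq_LIMSEQ[OF that r] by (simp add: comp_def)
  have suba: "(\<lambda>n. f (r n)) \<longlonglongrightarrow> l" if "f \<longlonglongrightarrow> l" for f :: "nat \<Rightarrow> 'a" and l
    using LIMSEQ_subseq_LIMSEQ[OF that r] by (simp add: comp_def)
  have x0: "(\<lambda>n. x (r n)) \<longlonglongrightarrow> p" using xr by (simp add: comp_def)
  have y0: "(\<lambda>n. y (r n)) \<longlonglongrightarrow> q" using yr by (simp add: comp_def)
  have x1: "(\<lambda>n. x (Suc (r n))) \<longlonglongrightarrow> p" using tendsto_add[OF suba[OF x_diff[OF sol]] x0] by simp
  have y1: "(\<lambda>n. y (Suc (r n))) \<longlonglongrightarrow> q" using tendsto_add[OF subb[OF y_diff[OF sol]] y0] by simp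
  have x2: "(\<lambda>n. x (Suc (Suc (r n)))) \<longlonglongrightarrow> p"
    using tendsto_add[OF suba[OF LIMSEQ_Suc[OF x_diff[OF sol]]] x1] by simp
  have ex: "(\<lambda>n. ex (r n)) \<longlonglongrightarrow> p" using tendsto_diff[OF x2 suba[OF ex_diff[OF sol]]] by simp
  note bl = linear_conv_bounded_linear[THEN iffD1, OF linear(1)]
    linear_conv_bounded_linear[THEN iffD1, OF linear(2)]
  have G: "p \<in> G \<and> gr p \<le> gr u - Kt q \<bullet> (p - u)" if u: "u \<in> G" for u
  proof (rule G_lim)
    let ?e = "\<lambda>n. (x n - \<alpha> n *\<^sub>R (x n - xa (Suc n)) - x (Suc n)) \<bullet> (x (Suc n) - u)"
    let ?c = "\<lambda>n. gr u + ?e (r n) / T (r n) - Kt (y (r n)) \<bullet> (x (Suc (r n)) - u)"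
    show "x (Suc (r n)) \<in> G" for n by (rule x_mem)
    show "gr (x (Suc (r n))) \<le> ?c n" for n
    proof -
      have "T (r n) * (gr (x (Suc (r n))) - gr u)
          \<le> ?e (r n) - T (r n) * (Kt (y (r n)) \<bullet> (x (Suc (r n)) - u))"
        using x_var[OF u, of "r n"] by (simp add: inner_diff_left)
      then show ?thesis using T_pos[of "r n"] by (simp add: field_simps)
    qed
    show "(\<lambda>n. x (Suc (r n))) \<longlonglongrightarrow> p" by (rule x1)
    have "(\<lambda>n. ?e (r n)) \<longlonglongrightarrow> (p - 0 - p) \<bullet> (p - u)"
      by (intro tendsto_intros x0 x1 suba[OF \<alpha>_diff[OF sol]])
    then have "(\<lambda>n. ?e (r n) / T (r n)) \<longlonglongrightarrow> 0" by (intro divide_T_tendsto_0) simp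
    then have "?c \<longlonglongrightarrow> gr u + 0 - Kt q \<bullet> (p - u)"
      by (intro tendsto_intros x1 bounded_linear.tendsto[OF bl(2)] y0)
    then show "?c \<longlonglongrightarrow> gr u - Kt q \<bullet> (p - u)" by simp
  qed
  have H: "q \<in> H \<and> hr q \<le> hr v + K p \<bullet> (q - v)" if v: "v \<in> H" for v
  proof (rule H_lim)
    let ?e = "\<lambda>n. (y n - \<gamma> n *\<^sub>R (y n - ya (Suc n)) - y (Suc n)) \<bullet> (y (Suc n) - v) / \<beta>"
    let ?c = "\<lambda>n. hr v + ?e (r n) / T (Suc (r n)) + K (ex (r n)) \<bullet> (y (Suc (r n)) - v)"
    show "y (Suc (r n)) \<in> H" for n by (rule y_mem)
    show "hr (y (Suc (r n))) \<le> ?c n" for n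
    proof -
      have "\<beta> * T (Suc (r n)) * (hr (y (Suc (r n))) - hr v)
          \<le> \<beta> * ?e (r n) + \<beta> * T (Suc (r n)) * (K (ex (r n)) \<bullet> (y (Suc (r n)) - v))"
        using y_var[OF v, of "r n"] \<beta> by (simp add: inner_diff_left inner_add_left ex_def)
      then have "\<beta> * (T (Suc (r n)) * (hr (y (Suc (r n))) - hr v))
          \<le> \<beta> * (?e (r n) + T (Suc (r n)) * (K (ex (r n)) \<bullet> (y (Suc (r n)) - v)))"
        by (simp only: mult.assoc distrib_left)
      then have "T (Suc (r n)) * (hr (y (Suc (r n))) - hr v)
          \<le> ?e (r n) + T (Suc (r n)) * (K (ex (r n)) \<bullet> (y (Suc (r n)) - v))"
        using \<beta> by (simp only: mult_le_cancel_left_pos)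
      then have "hr (y (Suc (r n))) - hr v
          \<le> (?e (r n) + T (Suc (r n)) * (K (ex (r n)) \<bullet> (y (Suc (r n)) - v))) / T (Suc (r n))"
        using T_pos[of "Suc (r n)"] by (simp only: pos_le_divide_eq mult.commute)
      then show ?thesis using T_pos[of "Suc (r n)"] by (simp add: add_divide_distrib)
    qed
    show "(\<lambda>n. y (Suc (r n))) \<longlonglongrightarrow> q" by (rule y1)
    have "(\<lambda>n. ?e (r n)) \<longlonglongrightarrow> (q - 0 - q) \<bullet> (q - v) / \<beta>"
      by (intro tendsto_intros y0 y1 subb[OF \<gamma>_diff[OF sol]]) (use \<beta> in auto)
    then have "(\<lambda>n. ?e (r n) / T (Suc (r n))) \<longlonglongrightarrow> 0" by (intro divide_T_tendsto_0) simp
    then have "?c \<longlonglongrightarrow> hr v + 0 + K p \<bullet> (q - v)"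
      by (intro tendsto_intros y1 bounded_linear.tendsto[OF bl(1)] ex)
    then show "?c \<longlonglongrightarrow> hr v + K p \<bullet> (q - v)" by simp
  qed
  have mem: "p \<in> G" "q \<in> H" using G[of p0] H[of q0] sol by (auto simp: sol_def)
  show ?thesis unfolding sol_def
  proof (intro conjI ballI mem)
    fix u assume "u \<in> G"
    from G[OF this] show "gr p + K p \<bullet> q \<le> gr u + K u \<bullet> q"
      unfolding adj by (simp add: inner_diff_right inner_commute[of "Kt q"])
  next
    fix v assume "v \<in> H"
    from H[OF this] show "hr q - K p \<bullet> q \<le> hr v - K p \<bullet> v"
      by (simp add: inner_diff_right)
  qed
qed

lemma primal_convergence:
  assumes sol: "sol p0 q0"
  shows "\<exists>p. sol p q0 \<and> x \<longlonglongrightarrow> p"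
proof -
  have suc: "bounded (range (\<lambda>n. f (Suc n)))" if "bounded (range f)" for f :: "nat \<Rightarrow> 'a"
    using that by (rule bounded_subset) auto
  have "\<exists>p\<in>{p. sol p q0}. (\<lambda>n. x (Suc n)) \<longlonglongrightarrow> p"
  proof (rule averaging_opial[where c = "\<lambda>n. \<alpha> (Suc n)" and w = "\<lambda>n. xa (Suc n)"])
    show "0 \<le> \<alpha> (Suc n)" "\<alpha> (Suc n) \<le> 1" for n
      using \<alpha>(1)[of "Suc n"] one_minus_pos[of "Suc n"] by auto
    show "convergent (\<lambda>n. \<alpha> (Suc n))" using convergent_\<alpha> by (simp add: convergent_Suc_iff)
    show "xa (Suc (Suc n)) = (1 - \<alpha> (Suc n)) *\<^sub>R xa (Suc n) + \<alpha> (Suc n) *\<^sub>R x (Suc n)" for n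
      by (rule xa_Suc)
    show "bounded (range (\<lambda>n. xa (Suc n)))" "bounded (range (\<lambda>n. x (Suc n)))"
      by (intro suc bounded_x[OF sol] bounded_xa[OF sol])+
  next
    fix r :: "nat \<Rightarrow> nat" and p
    assume r: "strict_mono r" "((\<lambda>n. x (Suc n)) \<circ> r) \<longlonglongrightarrow> p"
    have "bounded (range (y \<circ> (Suc \<circ> r)))" using bounded_y[OF sol] by (rule bounded_subset) auto
    then obtain q s where s: "strict_mono (s :: nat \<Rightarrow> nat)" "((y \<circ> (Suc \<circ> r)) \<circ> s) \<longlonglongrightarrow> q"
      using bounded_imp_convergent_subsequence by blast
    have "sol p q"
    proof (rule cluster_sol[OF sol, of "Suc \<circ> r \<circ> s"])
      show "strict_mono (Suc \<circ> r \<circ> s)" using r(1) s(1) by (simp add: strict_mono_def)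
      show "(x \<circ> (Suc \<circ> r \<circ> s)) \<longlonglongrightarrow> p"
        using LIMSEQ_subseq_LIMSEQ[OF r(2) s(1)] by (simp add: comp_def)
      show "(y \<circ> (Suc \<circ> r \<circ> s)) \<longlonglongrightarrow> q" using s(2) by (simp add: comp_def)
    qed
    \<comment> \<open>The cluster pair comes with its own dual part; the product structure exchanges
      it for \<open>q0\<close>, so that all primal cluster points share one gap term.\<close>
    then show "p \<in> {p. sol p q0}" using sol_swap sol by blast
  next
    fix p p' assume "p \<in> {p. sol p q0}" "p' \<in> {p. sol p q0}"
    then have s: "sol p q0" "sol p' q0" by auto
    have "convergent (\<lambda>n. lyap p q0 n - lyap p' q0 n)"
      by (intro convergent_diff convergent_lyap s)
    moreover have "lyap p q0 n - lyap p' q0 n =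
       ((norm (x (Suc n) - p))\<^sup>2 + (1 - \<alpha> (Suc n)) * (norm (xa (Suc n) - p))\<^sup>2)
     - ((norm (x (Suc n) - p'))\<^sup>2 + (1 - \<alpha> (Suc n)) * (norm (xa (Suc n) - p'))\<^sup>2)" for n
      unfolding lyap_def gap_primal_indep[OF s] by simp
    ultimately show "convergent (\<lambda>n.
       ((norm (x (Suc n) - p))\<^sup>2 + (1 - \<alpha> (Suc n)) * (norm (xa (Suc n) - p))\<^sup>2)
     - ((norm (x (Suc n) - p'))\<^sup>2 + (1 - \<alpha> (Suc n)) * (norm (xa (Suc n) - p'))\<^sup>2))"
      by simp
  qed
  then show ?thesis using LIMSEQ_imp_Suc by blast
qed

section \<open>Convergence of the dual iterates\<close>

text \<open>What is left of \<open>\<beta> * lyap p q n\<close> after removing the primal distances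
  and the anchor term. The gap stays in it, because its step-size coefficient may be
  unbounded.\<close>

definition dual_lyap :: "'a \<Rightarrow> 'b \<Rightarrow> nat \<Rightarrow> real" where
  "dual_lyap p q n = (norm (y n - q))\<^sup>2 + (1 - \<gamma> n) * (norm (ya n - q))\<^sup>2
     + 2 * \<beta> * T (Suc n) * Th (Suc n) * gap p q (x n)"

text \<open>The removed terms have to converge. The average \<open>xa\<close> may miss
  \<open>p\<close> when \<alpha> is summable, but it is mixed with points tending to
  \<open>p\<close>, so its distance to \<open>p\<close> can increase only below any given level and
  therefore converges.\<close>

lemma convergent_dual_lyap:
  assumes sol: "sol p q" and xp: "x \<longlonglongrightarrow> p"
  shows "convergent (dual_lyap p q)"
proof -
  have "convergent (\<lambda>n. norm (xa n - p))"
  proof (rule convergent_of_max_steps)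
    obtain B where "\<And>n. norm (xa n) \<le> B" using bounded_xa[OF sol] by (auto simp: bounded_iff)
    then have "norm (norm (xa n - p)) \<le> B + norm p" for n
      using norm_triangle_ineq4[of "xa n" p] by (smt (verit) norm_ge_zero real_norm_def)
    then show "bounded (range (\<lambda>n. norm (xa n - p)))" by (auto simp: bounded_iff)
  next
    fix e :: real assume e: "e > 0"
    then have "eventually (\<lambda>n. norm (x n - p) < e) sequentially"
      using tendstoD[OF xp] by (simp add: dist_norm)
    then show "eventually (\<lambda>n. norm (xa (Suc n) - p) \<le> max (norm (xa n - p)) e) sequentially"
    proof eventually_elim
      case (elim n)
      have a: "0 \<le> \<alpha> n" "0 \<le> 1 - \<alpha> n" using \<alpha>(1)[of n] one_minus_pos[of n] by auto
      have "xa (Suc n) - p = (1 - \<alpha> n) *\<^sub>R (xa n - p) + \<alpha> n *\<^sub>R (x n - p)"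
        by (simp add: xa_Suc algebra_simps)
      then have "norm (xa (Suc n) - p) \<le> (1 - \<alpha> n) * norm (xa n - p) + \<alpha> n * norm (x n - p)"
        using norm_triangle_ineq[of "(1 - \<alpha> n) *\<^sub>R (xa n - p)" "\<alpha> n *\<^sub>R (x n - p)"] a by simp
      also have "\<dots> \<le> max (norm (xa n - p)) e"
        by (rule convex_bound_le) (use a elim in auto)
      finally show ?case .
    qed
    show "eventually (\<lambda>n. - norm (xa (Suc n) - p) \<le> max (- norm (xa n - p)) e) sequentially"
      using e by (intro always_eventually allI) (smt (verit) norm_ge_zero)
  qed
  then obtain w where w: "(\<lambda>n. norm (xa n - p)) \<longlonglongrightarrow> w" by (auto simp: convergent_def)
  obtain a where a: "\<alpha> \<longlonglongrightarrow> a" using convergent_\<alpha> by (auto simp: convergent_def)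
  obtain L where L: "lyap p q \<longlonglongrightarrow> L" using convergent_lyap[OF sol] by (auto simp: convergent_def)
  have "(\<lambda>n. \<beta> * (lyap p q n - ((norm (x (Suc n) - p))\<^sup>2 + (1 - \<alpha> (Suc n)) * (norm (xa (Suc n) - p))\<^sup>2)
        - \<alpha> n * (norm (x n - xa (Suc n)))\<^sup>2)) \<longlonglongrightarrow> \<beta> * (L - ((norm (p - p))\<^sup>2 + (1 - a) * w\<^sup>2) - 0)"
    by (intro tendsto_intros L \<alpha>_sq[OF sol] LIMSEQ_Suc[OF xp] LIMSEQ_Suc[OF a] LIMSEQ_Suc[OF w])
  moreover have "\<beta> * (lyap p q n - ((norm (x (Suc n) - p))\<^sup>2 + (1 - \<alpha> (Suc n)) * (norm (xa (Suc n) - p))\<^sup>2)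
        - \<alpha> n * (norm (x n - xa (Suc n)))\<^sup>2) = dual_lyap p q n" for n
    using \<beta> by (simp add: lyap_def dual_lyap_def field_simps)
  ultimately show ?thesis by (auto simp: convergent_def)
qed

lemma Kt_tendsto: "f \<longlonglongrightarrow> l \<Longrightarrow> (\<lambda>n. Kt (f n)) \<longlonglongrightarrow> Kt l"
  by (rule bounded_linear.tendsto[OF linear_conv_bounded_linear[THEN iffD1, OF linear(2)]])

text \<open>Without cuts in the linesearch the step sizes grow geometrically, so by the linesearch criterion
  the increments of \<^term>\<open>\<lambda>n. Kt (y n)\<close> are summable.\<close>

lemma convergent_Kt_y:
  assumes sol: "sol p q" and N: "\<And>n. n \<ge> N \<Longrightarrow> Th (Suc n) = sqrt (1 + Th n)"
  shows "convergent (\<lambda>n. Kt (y n))"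
proof -
  \<comment> \<open>One uncut step lifts \<open>Th\<close> to at least 1 and the following one to at
    least \<open>sqrt 2\<close>, so the geometric growth is counted from
    \<open>Suc N\<close>.\<close>
  have Th1: "1 \<le> Th n" if "n \<ge> Suc N" for n
  proof -
    from that obtain m where m: "n = Suc m" "m \<ge> N" by (cases n) auto
    show ?thesis using N[OF m(2)] Th_nonneg[of m] by (simp add: m(1))
  qed
  have Th2: "sqrt 2 \<le> Th (Suc n)" if "n \<ge> Suc N" for n
    using N[of n] Th1[OF that] that by simp
  have growth: "tmin * sqrt 2 ^ k \<le> T (k + Suc N)" for k
  proof (induction k)
    case 0
    then show ?case using T(1) by simp
  next
    case (Suc k)
    have "tmin * sqrt 2 ^ Suc k = sqrt 2 * (tmin * sqrt 2 ^ k)" by simp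
    also have "\<dots> \<le> Th (Suc (k + Suc N)) * T (k + Suc N)"
      using Suc Th2[of "k + Suc N"] Th_nonneg tmin by (intro mult_mono) auto
    finally show ?case using T(2)[of "k + Suc N"] by simp
  qed
  obtain B where B: "\<And>n. norm (y (Suc n) - y n) \<le> B"
    using y_diff[OF sol] convergent_imp_Bseq[of "\<lambda>n. y (Suc n) - y n"]
    by (auto simp: convergent_def Bseq_def)
  define C where "C = \<delta> * B / (sqrt \<beta> * tmin)"
  let ?f = "\<lambda>k. Kt (y (Suc (k + Suc N))) - Kt (y (k + Suc N))"
  have "norm (?f k) \<le> C * (1 / sqrt 2) ^ k" for k
  proof -
    have "sqrt \<beta> * (tmin * sqrt 2 ^ k) * norm (?f k) \<le> sqrt \<beta> * T (Suc (k + Suc N)) * norm (?f k)"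
    proof (intro mult_right_mono mult_left_mono)
      have "tmin * sqrt 2 ^ k \<le> tmin * sqrt 2 ^ Suc k" using tmin by (intro mult_left_mono power_increasing) auto
      also have "\<dots> \<le> T (Suc (k + Suc N))" using growth[of "Suc k"] by simp
      finally show "tmin * sqrt 2 ^ k \<le> T (Suc (k + Suc N))" .
    qed (use \<beta> in auto)
    also have "\<dots> \<le> \<delta> * norm (y (Suc (k + Suc N)) - y (k + Suc N))" by (rule linesearch)
    also have "\<dots> \<le> \<delta> * B" using B \<delta> by (intro mult_left_mono)
    finally show ?thesis using \<beta> tmin by (simp add: C_def field_simps)
  qed
  moreover have "summable (\<lambda>k. C * (1 / sqrt 2) ^ k)" by (intro summable_mult summable_geometric) simp
  ultimately have "summable ?f" using summable_comparison_test'[of "\<lambda>k. C * (1 / sqrt 2) ^ k" 0 ?f] by blast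
  then have "convergent (\<lambda>k. Kt (y (k + Suc N)))"
    using summable_iff_convergent[of ?f]
      sum_lessThan_telescope[of "\<lambda>k. Kt (y (k + Suc N))"]
    by (simp add: convergent_diff_const_right_iff)
  then obtain L where "(\<lambda>k. Kt (y (k + Suc N))) \<longlonglongrightarrow> L" unfolding convergent_def by blast
  then have "(\<lambda>n. Kt (y n)) \<longlonglongrightarrow> L" by (rule LIMSEQ_offset)
  then show ?thesis by (auto simp: convergent_def)
qed

lemma dual_convergence_uncut:
  assumes sol: "sol p q0" and xp: "x \<longlonglongrightarrow> p"
    and Kc: "convergent (\<lambda>n. Kt (y n))"
  shows "\<exists>q. sol p q \<and> y \<longlonglongrightarrow> q"
proof -
  obtain \<kappa> where \<kappa>: "(\<lambda>n. Kt (y n)) \<longlonglongrightarrow> \<kappa>" using Kc by (auto simp: convergent_def)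
  \<comment> \<open>The gap depends on \<open>q\<close> only through \<open>Kt q\<close>, so within
    this set it drops out of differences of \<open>dual_lyap\<close>.\<close>
  have "\<exists>q\<in>{q. sol p q \<and> Kt q = \<kappa>}. y \<longlonglongrightarrow> q"
  proof (rule averaging_opial[where c = \<gamma> and w = ya])
    show "0 \<le> \<gamma> n" "\<gamma> n \<le> 1" for n using \<gamma>(1)[of n] one_minus_pos[of n] by auto
    show "convergent \<gamma>" by (rule convergent_\<gamma>)
    show "ya (Suc n) = (1 - \<gamma> n) *\<^sub>R ya n + \<gamma> n *\<^sub>R y n" for n by (rule ya_Suc)
    show "bounded (range ya)" "bounded (range y)" by (intro bounded_y[OF sol] bounded_ya[OF sol])+
  next
    fix r :: "nat \<Rightarrow> nat" and q assume r: "strict_mono r" "(y \<circ> r) \<longlonglongrightarrow> q"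
    have "Kt q = \<kappa>"
      using LIMSEQ_unique[OF Kt_tendsto[OF r(2)]] LIMSEQ_subseq_LIMSEQ[OF \<kappa> r(1)] by (simp add: comp_def)
    then show "q \<in> {q. sol p q \<and> Kt q = \<kappa>}"
      using cluster_sol[OF sol r(1) LIMSEQ_subseq_LIMSEQ[OF xp r(1)] r(2)] by simp
  next
    fix q q' assume "q \<in> {q. sol p q \<and> Kt q = \<kappa>}" "q' \<in> {q. sol p q \<and> Kt q = \<kappa>}"
    then have s: "sol p q" "sol p q'" "Kt q = Kt q'" by auto
    have "convergent (\<lambda>n. dual_lyap p q n - dual_lyap p q' n)"
      by (intro convergent_diff convergent_dual_lyap s xp)
    moreover have "dual_lyap p q n - dual_lyap p q' n =
       ((norm (y n - q))\<^sup>2 + (1 - \<gamma> n) * (norm (ya n - q))\<^sup>2)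
     - ((norm (y n - q'))\<^sup>2 + (1 - \<gamma> n) * (norm (ya n - q'))\<^sup>2)" for n
      by (simp add: dual_lyap_def gap_def s(3))
    ultimately show "convergent (\<lambda>n. ((norm (y n - q))\<^sup>2 + (1 - \<gamma> n) * (norm (ya n - q))\<^sup>2)
     - ((norm (y n - q'))\<^sup>2 + (1 - \<gamma> n) * (norm (ya n - q'))\<^sup>2))"
      by simp
  qed
  then show ?thesis by blast
qed

text \<open>A cut makes a fixed fraction of \<^term>\<open>T (Suc (Suc n)) * Th (Suc (Suc n)) * gap p q (x (Suc n))\<close>
  part of \<^term>\<open>cut p q n\<close>, which forces this term to vanish along the cuts. Hence the step sizes
  need not be bounded above.\<close>

lemma gap_term_le_cut:
  assumes sol: "sol p q" and c: "Th (Suc (Suc n)) \<le> \<mu> * sqrt (1 + Th (Suc n))"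
  shows "(1 / \<mu>\<^sup>2 - 1) * (2 * T (Suc (Suc n)) * Th (Suc (Suc n)) * gap p q (x (Suc n))) \<le> cut p q n"
proof -
  have "(Th (Suc (Suc n)))\<^sup>2 \<le> (\<mu> * sqrt (1 + Th (Suc n)))\<^sup>2" using c Th_nonneg by (rule power_mono)
  then have "(Th (Suc (Suc n)))\<^sup>2 \<le> \<mu>\<^sup>2 * (1 + Th (Suc n))"
    using Th_nonneg[of "Suc n"] by (simp add: power_mult_distrib)
  then have "T (Suc n) * (Th (Suc (Suc n)))\<^sup>2 \<le> T (Suc n) * (\<mu>\<^sup>2 * (1 + Th (Suc n)))"
    using T_pos[of "Suc n"] by (intro mult_left_mono) auto
  then have "1 / \<mu>\<^sup>2 * (T (Suc (Suc n)) * Th (Suc (Suc n))) \<le> T (Suc n) * (1 + Th (Suc n))"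
    unfolding T_Th_Suc using \<mu> by (simp add: field_simps)
  from mult_right_mono[OF this gap_nonneg[OF sol x_mem[of n]]]
  show ?thesis unfolding cut_def by (simp add: algebra_simps)
qed

text \<open>Along the cuts the iterate reaches \<open>q\<close> and the gap term vanishes, so the
  whole limit of \<open>dual_lyap p q\<close> is carried by the average:
  \<open>l = (1 - c') * (norm (v - q))\<^sup>2\<close>. Conversely, the distance of the average
  cannot increase while it exceeds a level slightly below \<open>l\<close>, so it converges along
  the full sequence to its value on the cuts. This exhausts \<open>l\<close> and leaves nothing for
  the distance of the iterate.\<close>

lemma dual_convergence_cut:
  assumes sol: "sol p q0" and xp: "x \<longlonglongrightarrow> p"
    and inf: "infinite {n. Th (Suc (Suc n)) \<le> \<mu> * sqrt (1 + Th (Suc n))}"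
  shows "\<exists>q. sol p q \<and> y \<longlonglongrightarrow> q"
proof -
  obtain r0 :: "nat \<Rightarrow> nat" where r0: "strict_mono r0"
      "\<And>n. Th (Suc (Suc (r0 n))) \<le> \<mu> * sqrt (1 + Th (Suc (r0 n)))"
    using infinite_enumerate[OF inf] by blast
  have "bounded (range (y \<circ> (Suc \<circ> r0)))" using bounded_y[OF sol] by (rule bounded_subset) auto
  then obtain q r1 where r1: "strict_mono (r1 :: nat \<Rightarrow> nat)" "((y \<circ> (Suc \<circ> r0)) \<circ> r1) \<longlonglongrightarrow> q"
    using bounded_imp_convergent_subsequence by blast
  have "bounded (range (ya \<circ> (Suc \<circ> r0 \<circ> r1)))" using bounded_ya[OF sol] by (rule bounded_subset) auto
  then obtain v r2 where r2: "strict_mono (r2 :: nat \<Rightarrow> nat)" "((ya \<circ> (Suc \<circ> r0 \<circ> r1)) \<circ> r2) \<longlonglongrightarrow> v"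
    using bounded_imp_convergent_subsequence by blast
  define r where "r = r0 \<circ> r1 \<circ> r2"
  \<comment> \<open>A cut recorded at \<open>r n\<close> controls the gap at
    \<open>x (Suc (r n))\<close>, so the Lyapunov function is evaluated one index later.\<close>
  define R where "R = Suc \<circ> r"
  have r: "strict_mono r" "strict_mono R"
    using r0(1) r1(1) r2(1) by (auto simp: r_def R_def strict_mono_def)
  have yR: "(y \<circ> R) \<longlonglongrightarrow> q"
    using LIMSEQ_subseq_LIMSEQ[OF r1(2) r2(1)] by (simp add: R_def r_def comp_def)
  have vR: "(ya \<circ> R) \<longlonglongrightarrow> v" using r2(2) by (simp add: R_def r_def comp_def)
  have sq: "sol p q" by (rule cluster_sol[OF sol r(2) LIMSEQ_subseq_LIMSEQ[OF xp r(2)] yR])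
  obtain l where l: "dual_lyap p q \<longlonglongrightarrow> l"
    using convergent_dual_lyap[OF sq xp] by (auto simp: convergent_def)
  obtain c' where c': "\<gamma> \<longlonglongrightarrow> c'" using convergent_\<gamma> by (auto simp: convergent_def)
  have c'1: "c' \<le> 1 - \<eta>" "0 \<le> c'"
    by (rule LIMSEQ_le_const2[OF c'], use \<gamma>_le in blast, rule LIMSEQ_le_const[OF c'], use \<gamma>(1) less_imp_le in blast)
  define s w g where "s n = (norm (y n - q))\<^sup>2" and "w n = (norm (ya n - q))\<^sup>2"
    and "g n = 2 * T (Suc n) * Th (Suc n) * gap p q (x n)" for n
  have dl: "dual_lyap p q n = s n + (1 - \<gamma> n) * w n + \<beta> * g n" for n
    by (simp add: dual_lyap_def s_def w_def g_def)
  have gR: "(g \<circ> R) \<longlonglongrightarrow> 0"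
  proof -
    define m where "m = 1 / \<mu>\<^sup>2 - 1"
    have "\<mu>\<^sup>2 < 1" using \<mu> by (simp add: power_less_one_iff)
    then have m: "m > 0" using \<mu> by (simp add: m_def field_simps)
    have "(\<lambda>n. cut p q (r n) / m) \<longlonglongrightarrow> 0 / m"
      using LIMSEQ_subseq_LIMSEQ[OF cut_tendsto[OF sq] r(1)] m
      by (intro tendsto_intros) (auto simp: comp_def)
    then have lim: "(\<lambda>n. cut p q (r n) / m) \<longlonglongrightarrow> 0" by simp
    have "(g \<circ> R) n \<le> cut p q (r n) / m" for n
      using gap_term_le_cut[OF sq r0(2), of "r1 (r2 n)"] m
      by (simp add: g_def R_def r_def m_def[symmetric] pos_le_divide_eq mult.commute mult.left_commute)
    moreover have "0 \<le> (g \<circ> R) n" for n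
      unfolding g_def R_def comp_def
      using gap_nonneg[OF sq x_mem] T_pos Th_nonneg by (intro mult_nonneg_nonneg) (auto simp: less_imp_le)
    ultimately show ?thesis
      by (intro tendsto_sandwich[OF _ _ tendsto_const lim]) auto
  qed
  have wR: "(w \<circ> R) \<longlonglongrightarrow> (norm (v - q))\<^sup>2"
    using vR unfolding w_def comp_def by (intro tendsto_intros)
  have "(\<lambda>n. (s \<circ> R) n + (1 - (\<gamma> \<circ> R) n) * (w \<circ> R) n + \<beta> * (g \<circ> R) n)
      \<longlonglongrightarrow> (norm (q - q))\<^sup>2 + (1 - c') * (norm (v - q))\<^sup>2 + \<beta> * 0"
  proof (intro tendsto_intros gR wR LIMSEQ_subseq_LIMSEQ[OF c' r(2)])
    have "(\<lambda>n. (norm (y (R n) - q))\<^sup>2) \<longlonglongrightarrow> (norm (q - q))\<^sup>2"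
      using yR unfolding comp_def by (intro tendsto_intros)
    then show "(s \<circ> R) \<longlonglongrightarrow> (norm (q - q))\<^sup>2" by (simp add: s_def comp_def)
  qed
  moreover have "(\<lambda>n. (s \<circ> R) n + (1 - (\<gamma> \<circ> R) n) * (w \<circ> R) n + \<beta> * (g \<circ> R) n) \<longlonglongrightarrow> l"
    using LIMSEQ_subseq_LIMSEQ[OF l r(2)] by (simp add: dl comp_def)
  ultimately have lv: "l = (1 - c') * (norm (v - q))\<^sup>2" using LIMSEQ_unique by fastforce
  have l0: "0 \<le> l" unfolding lv using c'1 \<eta> by simp
  have g0: "0 \<le> g (Suc n)" for n
    unfolding g_def
    using gap_nonneg[OF sq x_mem] T_pos Th_nonneg by (intro mult_nonneg_nonneg) (auto simp: less_imp_le)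
  have sw: "s (Suc n) + (1 - \<gamma> (Suc n)) * w (Suc n) \<le> dual_lyap p q (Suc n)" for n
    using g0[of n] \<beta> by (simp add: dl)
  have w0: "0 \<le> w n" "0 \<le> s n" for n by (auto simp: w_def s_def)
  have "w \<longlonglongrightarrow> (norm (v - q))\<^sup>2" if "l > 0"
  proof -
    \<comment> \<open>Chosen such that \<open>(2 - \<gamma> 0) * c0\<close> is the midpoint of
      \<open>l\<close> and \<open>(2 - \<gamma> 0) * l\<close>: it lies strictly above
      \<open>l\<close>, hence eventually above \<open>dual_lyap\<close>, while \<open>c0\<close>
      stays strictly below \<open>l\<close>.\<close>
    define c0 where "c0 = l * (3 - \<gamma> 0) / 2 / (2 - \<gamma> 0)"
    have \<gamma>0: "0 < \<gamma> 0" "\<gamma> 0 < 1" using \<gamma>(1)[of 0] one_minus_pos[of 0] by auto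
    have "l * (3 - \<gamma> 0) < l * (2 * (2 - \<gamma> 0))" using that \<gamma>0 by (intro mult_strict_left_mono) auto
    then have c0l: "c0 < l" using \<gamma>0 by (simp add: c0_def field_simps)
    have c00: "0 \<le> c0" using that \<gamma>0 by (simp add: c0_def)
    have "l \<le> (norm (v - q))\<^sup>2"
      unfolding lv using c'1 by (simp add: mult_left_le_one_le algebra_simps)
    with c0l have c0v: "c0 < (norm (v - q))\<^sup>2" by simp
    have "l < l * (3 - \<gamma> 0) / 2" using that \<gamma>0 by (simp add: field_simps)
    then have "eventually (\<lambda>n. dual_lyap p q n < l * (3 - \<gamma> 0) / 2) sequentially"
      using order_tendstoD(2)[OF l] by blast
    then have "eventually (\<lambda>n. dual_lyap p q n \<le> (2 - \<gamma> 0) * c0 \<and> n > 0) sequentially"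
      using eventually_gt_at_top[of 0]
    proof eventually_elim
      case (elim n)
      have "(2 - \<gamma> 0) * c0 = l * (3 - \<gamma> 0) / 2" using \<gamma>0 by (simp add: c0_def field_simps)
      then show ?case using elim by linarith
    qed
    then have step: "eventually (\<lambda>n. w (Suc n) \<le> max (w n) c0) sequentially"
    proof eventually_elim
      case (elim n)
      have c: "0 \<le> \<gamma> n" "0 \<le> 1 - \<gamma> n" "\<gamma> n \<le> \<gamma> 0"
        using \<gamma>(1)[of n] one_minus_pos[of n] decseqD[OF decseq_SucI[of \<gamma>], OF \<gamma>(2), of 0 n] by auto
      have sw': "s n \<le> (2 - \<gamma> n) * c0 - (1 - \<gamma> n) * w n"
      proof -
        have "(2 - \<gamma> 0) * c0 \<le> (2 - \<gamma> n) * c0" using c c00 by (intro mult_right_mono) auto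
        then show ?thesis using elim sw[of "n - 1"] by simp
      qed
      have "w (Suc n) = (norm ((1 - \<gamma> n) *\<^sub>R (ya n - q) + \<gamma> n *\<^sub>R (y n - q)))\<^sup>2"
        by (simp add: w_def ya_Suc algebra_simps)
      also have "\<dots> = (1 - \<gamma> n) * w n + \<gamma> n * s n
          - \<gamma> n * (1 - \<gamma> n) * (norm ((ya n - q) - (y n - q)))\<^sup>2"
        unfolding w_def s_def power2_norm_eq_inner
        by (simp add: inner_add_left inner_add_right inner_diff_left inner_diff_right inner_commute algebra_simps)
      also have "\<dots> \<le> (1 - \<gamma> n) * w n + \<gamma> n * s n" using c by simp
      \<comment> \<open>Bounding \<open>s n\<close> through the Lyapunov function closes the
        recursion in \<open>w\<close>: the result is a convex combination of \<open>w n\<close> and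
        \<open>c0\<close>.\<close>
      also have "\<dots> \<le> (1 - \<gamma> n) * w n + \<gamma> n * ((2 - \<gamma> n) * c0 - (1 - \<gamma> n) * w n)"
        using mult_left_mono[OF sw' c(1)] by simp
      also have "\<dots> = (1 - \<gamma> n)\<^sup>2 * w n + (\<gamma> n * (2 - \<gamma> n)) * c0"
        by (simp add: algebra_simps power2_eq_square)
      also have "\<dots> \<le> max (w n) c0"
      proof (rule convex_bound_le)
        show "0 \<le> \<gamma> n * (2 - \<gamma> n)" using c by (intro mult_nonneg_nonneg) auto
        show "(1 - \<gamma> n)\<^sup>2 + \<gamma> n * (2 - \<gamma> n) = 1" by (simp add: power2_eq_square algebra_simps)
      qed auto
      finally show ?case .
    qed
    show ?thesis by (rule converges_of_subseq_above[OF step r(2) wR c0v])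
  qed
  moreover have "(\<lambda>n. (1 - \<gamma> n) * w n) \<longlonglongrightarrow> l" if "w \<longlonglongrightarrow> (norm (v - q))\<^sup>2"
    unfolding lv by (intro tendsto_intros c' that)
  ultimately have up: "\<exists>u. u \<longlonglongrightarrow> 0 \<and> (\<forall>n. s (Suc n) \<le> u (Suc n))"
  proof (cases "l > 0")
    case True
    then have "(\<lambda>n. dual_lyap p q n - (1 - \<gamma> n) * w n) \<longlonglongrightarrow> l - l"
      using \<open>l > 0 \<Longrightarrow> _\<close> \<open>w \<longlonglongrightarrow> _ \<Longrightarrow> _\<close> by (intro tendsto_diff l) blast
    moreover have "s (Suc n) \<le> dual_lyap p q (Suc n) - (1 - \<gamma> (Suc n)) * w (Suc n)" for n
      using sw[of n] by simp
    ultimately show ?thesis by (intro exI[of _ "\<lambda>n. dual_lyap p q n - (1 - \<gamma> n) * w n"]) simp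
  next
    case False
    then have "dual_lyap p q \<longlonglongrightarrow> 0" using l l0 by simp
    moreover have "s (Suc n) \<le> dual_lyap p q (Suc n)" for n
    proof -
      have "0 \<le> (1 - \<gamma> (Suc n)) * w (Suc n)"
        using w0(1)[of "Suc n"] one_minus_pos(2)[of "Suc n"] by (intro mult_nonneg_nonneg) auto
      then show ?thesis using sw[of n] by linarith
    qed
    ultimately show ?thesis by blast
  qed
  then obtain u where u: "u \<longlonglongrightarrow> 0" "\<And>n. s (Suc n) \<le> u (Suc n)" by blast
  have "(\<lambda>n. s (Suc n)) \<longlonglongrightarrow> 0"
    by (rule tendsto_sandwich[OF _ _ tendsto_const LIMSEQ_Suc[OF u(1)]]) (use u(2) w0 in auto)
  then have "s \<longlonglongrightarrow> 0" by (rule LIMSEQ_imp_Suc)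
  then have "(\<lambda>n. y n - q) \<longlonglongrightarrow> 0" unfolding s_def by (rule norm_sq_tendsto_0)
  then show ?thesis using sq by (auto simp: LIM_zero_iff)
qed

lemma iterates_converge:
  assumes "sol p0 q0"
  shows "\<exists>p q. sol p q \<and> x \<longlonglongrightarrow> p \<and> y \<longlonglongrightarrow> q"
proof -
  obtain p where p: "sol p q0" "x \<longlonglongrightarrow> p" using primal_convergence[OF assms] by blast
  let ?C = "{n. Th (Suc (Suc n)) \<le> \<mu> * sqrt (1 + Th (Suc n))}"
  have "\<exists>q. sol p q \<and> y \<longlonglongrightarrow> q"
  proof (cases "infinite ?C")
    case True
    then show ?thesis by (rule dual_convergence_cut[OF p])
  next
    case False
    then obtain N where N: "\<And>n. n \<in> ?C \<Longrightarrow> n < N" using finite_nat_bounded[of ?C] by auto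
    \<comment> \<open>The set of cuts is indexed from the second step on, hence \<open>Suc N\<close>
      in place of \<open>N\<close>.\<close>
    have "Th (Suc n) = sqrt (1 + Th n)" if "n \<ge> Suc N" for n
    proof -
      from that obtain m where m: "n = Suc m" "m \<ge> N" by (cases n) auto
      show ?thesis using Th_step[of n] N[of m] m by auto
    qed
    then have "convergent (\<lambda>n. Kt (y n))" by (rule convergent_Kt_y[OF p(1)])
    then show ?thesis by (rule dual_convergence_uncut[OF p])
  qed
  then show ?thesis using p by blast
qed

end

section \<open>From the algorithm to the abstract linesearch setting\<close>

text \<open>By the operator bound \<open>B\<close>, every positive trial up to
  \<open>\<delta> / (sqrt \<beta> * B)\<close> is accepted, wherever the dual proximal point lies.
  So the geometric trials end in acceptance, which gives the \<open>LEAST\<close> its meaning; and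
  if there was a rejection, the last rejected trial exceeded this threshold, so the accepted one is
  at least \<mu> times the threshold.\<close>

lemma npdal_step_props:
  fixes K :: "'a::euclidean_space \<Rightarrow> 'b::euclidean_space"
  assumes B: "B > 0" "\<And>v. norm (adjoint K v) \<le> B * norm v" and lin: "linear (adjoint K)"
    and pos: "\<beta> > 0" "0 < \<mu>" "\<mu> < 1" "\<delta> > 0" "0 < tp" "0 < thp"
    and step: "npdal_step K g f a b \<beta> \<mu> \<delta> k (xp, xap, yk, yap, tp, thp) = (x', xa', y', ya', t', th')"
  shows "xa' = (1 - a k) *\<^sub>R xap + a k *\<^sub>R xp"
    and "ya' = (1 - b (Suc k)) *\<^sub>R yap + b (Suc k) *\<^sub>R yk"
    and "x' = prox tp g (xp - a k *\<^sub>R (xp - xa') - tp *\<^sub>R adjoint K yk)"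
    and "th' = t' / tp"
    and "y' = prox (\<beta> * t') (conj_fun f)
      (yk - b (Suc k) *\<^sub>R (yk - ya') + (\<beta> * t') *\<^sub>R K (x' + th' *\<^sub>R (x' - xp)))"
    and "sqrt \<beta> * t' * norm (adjoint K y' - adjoint K yk) \<le> \<delta> * norm (y' - yk)"
    and "\<exists>i. t' = \<mu> ^ i * (tp * sqrt (1 + thp)) \<and> (i = 0 \<or> \<mu> * (\<delta> / (sqrt \<beta> * B)) \<le> t')"
proof -
  define tr where "tr = tp * sqrt (1 + thp)"
  define xag where "xag = (1 - a k) *\<^sub>R xap + a k *\<^sub>R xp"
  define yag where "yag = (1 - b (Suc k)) *\<^sub>R yap + b (Suc k) *\<^sub>R yk"
  define xk where "xk = prox tp g ((1 - a k) *\<^sub>R xp + a k *\<^sub>R xag - tp *\<^sub>R adjoint K yk)"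
  define ynew where "ynew t = prox (\<beta> * t) (conj_fun f)
    ((1 - b (Suc k)) *\<^sub>R yk + b (Suc k) *\<^sub>R yag + (\<beta> * t) *\<^sub>R K (xk + (t / tp) *\<^sub>R (xk - xp)))" for t
  define accept where "accept t \<longleftrightarrow>
    sqrt \<beta> * t * norm (adjoint K (ynew t) - adjoint K yk) \<le> \<delta> * norm (ynew t - yk)" for t
  define i where "i = (LEAST i::nat. accept (\<mu> ^ i * tr))"
  have tr: "tr > 0" using pos by (simp add: tr_def)
  have eqs: "x' = xk" "xa' = xag" "y' = ynew (\<mu> ^ i * tr)" "ya' = yag" "t' = \<mu> ^ i * tr" "th' = t' / tp"
    using step unfolding npdal_step_def Let_def i_def accept_def ynew_def xk_def yag_def xag_def tr_def
    by auto
  have small: "accept t" if "0 < t" "t \<le> \<delta> / (sqrt \<beta> * B)" for t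
  proof -
    have "norm (adjoint K (ynew t) - adjoint K yk) \<le> B * norm (ynew t - yk)"
      using B(2)[of "ynew t - yk"] by (simp add: linear_diff[OF lin])
    then have "sqrt \<beta> * t * norm (adjoint K (ynew t) - adjoint K yk) \<le> sqrt \<beta> * t * (B * norm (ynew t - yk))"
      using that pos by (intro mult_left_mono) auto
    also have "\<dots> = (t * (sqrt \<beta> * B)) * norm (ynew t - yk)" by (simp add: mult_ac)
    also have "\<dots> \<le> \<delta> * norm (ynew t - yk)"
      using that B(1) pos by (intro mult_right_mono) (auto simp: pos_le_divide_eq)
    finally show ?thesis by (simp add: accept_def)
  qed
  have "\<delta> / (sqrt \<beta> * B) / tr > 0" using pos B(1) tr by simp
  then obtain m where "\<mu> ^ m < \<delta> / (sqrt \<beta> * B) / tr" using real_arch_pow_inv pos(3) by blast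
  then have "\<mu> ^ m * tr < \<delta> / (sqrt \<beta> * B)" using tr by (simp only: pos_less_divide_eq)
  then have "accept (\<mu> ^ m * tr)" using pos tr by (intro small) auto
  then have acc: "accept (\<mu> ^ i * tr)" unfolding i_def by (rule LeastI)
  show "xa' = (1 - a k) *\<^sub>R xap + a k *\<^sub>R xp" "ya' = (1 - b (Suc k)) *\<^sub>R yap + b (Suc k) *\<^sub>R yk"
    "th' = t' / tp"
    by (simp_all add: eqs xag_def yag_def)
  show "x' = prox tp g (xp - a k *\<^sub>R (xp - xa') - tp *\<^sub>R adjoint K yk)"
    by (simp add: eqs xk_def algebra_simps)
  show "y' = prox (\<beta> * t') (conj_fun f)
      (yk - b (Suc k) *\<^sub>R (yk - ya') + (\<beta> * t') *\<^sub>R K (x' + th' *\<^sub>R (x' - xp)))"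
    unfolding eqs ynew_def by (simp add: algebra_simps)
  show "sqrt \<beta> * t' * norm (adjoint K y' - adjoint K yk) \<le> \<delta> * norm (y' - yk)"
    using acc by (simp add: accept_def eqs)
  have "\<mu> * (\<delta> / (sqrt \<beta> * B)) \<le> t'" if "i \<noteq> 0"
  proof -
    obtain j where j: "i = Suc j" using \<open>i \<noteq> 0\<close> by (cases i) auto
    then have "\<not> accept (\<mu> ^ j * tr)" unfolding i_def by (intro not_less_Least) simp
    then have "\<not> \<mu> ^ j * tr \<le> \<delta> / (sqrt \<beta> * B)" using small[of "\<mu> ^ j * tr"] pos tr by auto
    then have "\<mu> * (\<delta> / (sqrt \<beta> * B)) \<le> \<mu> * (\<mu> ^ j * tr)" using pos by (intro mult_left_mono) auto
    then show ?thesis by (simp add: eqs j mult.assoc)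
  qed
  then show "\<exists>i. t' = \<mu> ^ i * (tp * sqrt (1 + thp)) \<and> (i = 0 \<or> \<mu> * (\<delta> / (sqrt \<beta> * B)) \<le> t')"
    using eqs(5) by (auto simp: tr_def)
qed

theorem theorem3p5:
  fixes K :: "'a::euclidean_space \<Rightarrow> 'b::euclidean_space"
    and g :: "'a \<Rightarrow> ereal" and f :: "'b \<Rightarrow> ereal"
    and a b :: "nat \<Rightarrow> real"
    and \<tau>0 \<beta> \<mu> \<theta> \<delta> :: real and x0 :: 'a and y1 :: 'b
  assumes "linear K"
    and "proper_fun g" "closed_fun g" "convex_fun g"
    and "proper_fun f" "closed_fun f" "convex_fun f"
    and "\<exists>xh yh. saddle_point (lagr K g f) xh yh"
    and "\<forall>k\<ge>1. 0 < a k \<and> a k < 1" and "\<forall>k\<ge>1. a (Suc k) \<le> a k"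
    and "\<forall>k\<ge>1. 0 < b k \<and> b k < 1" and "\<forall>k\<ge>1. b (Suc k) \<le> b k"
    and "\<tau>0 > 0" and "\<beta> > 0" and "0 < \<mu>" and "\<mu> < 1"
    and "\<theta> > 0" and "\<forall>k. npdal_theta K g f a b \<beta> \<mu> \<delta> \<tau>0 x0 y1 k \<le> \<theta>"
    and "0 < \<delta>" and "\<delta> < 1"
    and "\<forall>k\<ge>1. \<delta> + \<theta>\<^sup>2 * a k + a k < 1" and "\<forall>k\<ge>1. \<delta> + b k < 1"
  shows "\<exists>xh yh. saddle_point (lagr K g f) xh yh \<and>
           ((\<lambda>k. (npdal_x K g f a b \<beta> \<mu> \<delta> \<tau>0 x0 y1 k, npdal_y K g f a b \<beta> \<mu> \<delta> \<tau>0 x0 y1 k))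
              \<longlonglongrightarrow> (xh, yh))"
proof -
  note K = assms(1) and g = assms(2-4) and f = assms(5-7) and ex_sol = assms(8)
    and a = assms(9,10) and b = assms(11,12) and \<tau>0 = assms(13) and \<beta> = assms(14)
    and \<mu> = assms(15,16) and th_le = assms(18) and \<delta> = assms(19,20) and cond = assms(21,22)
  define st where "st = npdal_state K g f a b \<beta> \<mu> \<delta> \<tau>0 x0 y1"
  define x where "x k = fst (st k)" for k
  define xa where "xa k = fst (snd (st k))" for k
  define y where "y k = fst (snd (snd (st k)))" for k
  define ya where "ya k = fst (snd (snd (snd (st k))))" for k
  define T where "T k = fst (snd (snd (snd (snd (st k)))))" for k
  define Th where "Th k = snd (snd (snd (snd (snd (st k)))))" for k
  have st: "st k = (x k, xa k, y k, ya k, T k, Th k)" for k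
    by (simp add: x_def xa_def y_def ya_def T_def Th_def)
  have f': "proper_fun (conj_fun f)" "closed_fun (conj_fun f)" "convex_fun (conj_fun f)"
    using proper_conj_fun[OF f] closed_conj_fun[OF f(1)] convex_conj_fun[OF f(1)] by auto
  have linKt: "linear (adjoint K)" using K by (rule adjoint_linear)
  then have "bounded_linear (adjoint K)" by (simp add: linear_conv_bounded_linear)
  then obtain B where B: "B > 0" "\<And>v. norm (adjoint K v) \<le> B * norm v"
    using bounded_linear.pos_bounded by (metis mult.commute)
  \<comment> \<open>A step without cut does not shrink the step size, and a step with a cut ends
    above the second entry of the minimum.\<close>
  define tmin where "tmin = min \<tau>0 (\<mu> * (\<delta> / (sqrt \<beta> * B)))"
  have tmin: "tmin > 0" using \<tau>0 \<mu> \<delta> \<beta> B(1) by (simp add: tmin_def)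
  have step: "npdal_step K g f a b \<beta> \<mu> \<delta> (Suc k) (x k, xa k, y k, ya k, T k, Th k)
      = (x (Suc k), xa (Suc k), y (Suc k), ya (Suc k), T (Suc k), Th (Suc k))" for k
    using st[of "Suc k"] st[of k] by (simp add: st_def)
  note props = npdal_step_props[OF B linKt \<beta> \<mu> \<delta>(1) _ _ step]
  have inv: "tmin \<le> T k \<and> 0 < Th k" for k
  proof (induction k)
    case 0
    then show ?case by (simp add: T_def Th_def st_def tmin_def)
  next
    case (Suc k)
    then have p: "0 < T k" "0 < Th k" using tmin by auto
    obtain i where i: "T (Suc k) = \<mu> ^ i * (T k * sqrt (1 + Th k))"
      "i = 0 \<or> \<mu> * (\<delta> / (sqrt \<beta> * B)) \<le> T (Suc k)" using props(7)[OF p] by blast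
    have "tmin \<le> T (Suc k)"
    proof (cases "i = 0")
      case True
      have "T k * 1 \<le> T k * sqrt (1 + Th k)" using p by (intro mult_left_mono) auto
      then show ?thesis using Suc i(1) True by simp
    next
      case False
      then show ?thesis using i(2) by (simp add: tmin_def)
    qed
    moreover have "0 < Th (Suc k)" using props(4)[OF p] p i(1) \<mu> by simp
    ultimately show ?case by simp
  qed
  have pos: "0 < T k" "0 < Th k" for k using inv[of k] tmin by auto
  note props = props[OF pos]
  \<comment> \<open>The abstract sequences start with \<open>a 1\<close> and \<open>b 2\<close>,
    their largest members, so the strict conditions at these two indices yield a slack valid for all
    steps.\<close>
  define \<eta> where "\<eta> = min (1 - \<delta> - \<theta>\<^sup>2 * a 1 - a 1) (1 - \<delta> - b 2)"
  have \<eta>: "\<eta> > 0" using cond(1)[rule_format, of 1] cond(2)[rule_format, of 2] by (simp add: \<eta>_def)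
  have a1: "a (Suc n) \<le> a 1" for n
    by (induction n) (use a(2) in \<open>auto intro: order_trans\<close>)
  have b1: "b (Suc (Suc n)) \<le> b 2" for n
    by (induction n) (use b(2) in \<open>auto simp: numeral_2_eq_2 intro: order_trans\<close>)
  let ?g = "\<lambda>x. real_of_ereal (g x)" and ?h = "\<lambda>y. real_of_ereal (conj_fun f y)"
  interpret primal_dual_linesearch K "adjoint K" "edom g" ?g "edom (conj_fun f)" ?h x xa y ya T Th
    "\<lambda>n. a (Suc n)" "\<lambda>n. b (Suc (Suc n))" \<beta> \<mu> \<delta> \<theta> \<eta> tmin
  proof (rule primal_dual_linesearch.intro)
    show "K u \<bullet> v = u \<bullet> adjoint K v" for u v using adjoint_works[OF K] by simp
    show "\<delta> + \<theta>\<^sup>2 * a (Suc n) + a (Suc n) + \<eta> \<le> 1" for n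
    proof -
      have "\<theta>\<^sup>2 * a (Suc n) \<le> \<theta>\<^sup>2 * a 1" using a1 by (intro mult_left_mono) auto
      then show ?thesis using a1[of n] by (simp add: \<eta>_def)
    qed
    show "\<delta> + b (Suc (Suc n)) + \<eta> \<le> 1" for n using b1[of n] by (simp add: \<eta>_def)
    show "Th n \<le> \<theta>" for n using th_le by (simp add: npdal_theta_def Th_def st_def)
    show "T (Suc n) = Th (Suc n) * T n" for n using props(4)[of n] pos(1)[of n] by simp
    show "Th (Suc n) = sqrt (1 + Th n) \<or> Th (Suc n) \<le> \<mu> * sqrt (1 + Th n)" for n
    proof -
      obtain i where i: "T (Suc n) = \<mu> ^ i * (T n * sqrt (1 + Th n))" using props(7)[of n] by blast
      then have e: "Th (Suc n) = \<mu> ^ i * sqrt (1 + Th n)"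
        using props(4)[of n] pos(1)[of n] by simp
      show ?thesis
      proof (cases i)
        case 0
        then show ?thesis using e by simp
      next
        case (Suc j)
        have "\<mu> ^ i \<le> \<mu>" using \<mu> mult_left_le[of "\<mu> ^ j" \<mu>] by (simp add: Suc power_le_one)
        then show ?thesis unfolding e using pos(2)[of n] by (intro disjI2 mult_right_mono) auto
      qed
    qed
    show "x (Suc n) \<in> edom g" for n
      using prox_variational(1)[OF g pos(1)] by (subst props(3))
    show "T n * (?g (x (Suc n)) - ?g u) \<le> (x n - a (Suc n) *\<^sub>R (x n - xa (Suc n)) - T n *\<^sub>R adjoint K (y n) - x (Suc n)) \<bullet> (x (Suc n) - u)"
      if "u \<in> edom g" for n u
      using prox_variational(2)[OF g pos(1) that] props(3)[of n] by metis
    have bt: "0 < \<beta> * T (Suc n)" for n using \<beta> pos by simp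
    show "y (Suc n) \<in> edom (conj_fun f)" for n
      using prox_variational(1)[OF f' bt] by (subst props(5))
    show "\<beta> * T (Suc n) * (?h (y (Suc n)) - ?h v)
      \<le> (y n - b (Suc (Suc n)) *\<^sub>R (y n - ya (Suc n)) +
          (\<beta> * T (Suc n)) *\<^sub>R K (x (Suc n) + Th (Suc n) *\<^sub>R (x (Suc n) - x n)) - y (Suc n))
        \<bullet> (y (Suc n) - v)" if "v \<in> edom (conj_fun f)" for n v
      using prox_variational(2)[OF f' bt that] props(5)[of n] by metis
    show "z' \<in> edom g \<and> ?g z' \<le> c'" if "\<And>n. z n \<in> edom g" "\<And>n. ?g (z n) \<le> c n"
      "z \<longlonglongrightarrow> z'" "c \<longlonglongrightarrow> c'" for z c z' c'
      by (rule closed_fun_limit[OF g(1,2) that])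
    show "z' \<in> edom (conj_fun f) \<and> ?h z' \<le> c'"
      if "\<And>n. z n \<in> edom (conj_fun f)" "\<And>n. ?h (z n) \<le> c n" "z \<longlonglongrightarrow> z'" "c \<longlonglongrightarrow> c'" for z c z' c'
      by (rule closed_fun_limit[OF f'(1,2) that])
    show "xa (Suc n) = (1 - a (Suc n)) *\<^sub>R xa n + a (Suc n) *\<^sub>R x n" for n by (rule props(1))
    show "ya (Suc n) = (1 - b (Suc (Suc n))) *\<^sub>R ya n + b (Suc (Suc n)) *\<^sub>R y n" for n by (rule props(2))
    show "sqrt \<beta> * T (Suc n) * norm (adjoint K (y (Suc n)) - adjoint K (y n)) \<le> \<delta> * norm (y (Suc n) - y n)" for n
      by (rule props(6))
  qed (use K linKt \<beta> \<mu> \<delta> \<eta> tmin a b inv in auto)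
  have sol_iff: "saddle_point (lagr K g f) p q \<longleftrightarrow> sol p q" for p q
    by (simp add: saddle_point_lagr_iff[OF g(1) f'(1)] sol_def)
  obtain p q where pq: "sol p q" "x \<longlonglongrightarrow> p" "y \<longlonglongrightarrow> q"
    using iterates_converge ex_sol sol_iff by blast
  \<comment> \<open>The state of index \<open>k\<close> stores the dual iterate of index
    \<open>Suc k\<close>.\<close>
  have "(\<lambda>k. npdal_y K g f a b \<beta> \<mu> \<delta> \<tau>0 x0 y1 (Suc k)) \<longlonglongrightarrow> q"
    using pq(3) by (simp add: npdal_y_def y_def[abs_def] st_def)
  then have "npdal_y K g f a b \<beta> \<mu> \<delta> \<tau>0 x0 y1 \<longlonglongrightarrow> q" by (rule LIMSEQ_imp_Suc)
  moreover have "npdal_x K g f a b \<beta> \<mu> \<delta> \<tau>0 x0 y1 \<longlonglongrightarrow> p"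
    using pq(2) by (simp add: npdal_x_def[abs_def] x_def[abs_def] st_def)
  ultimately show ?thesis using pq(1) sol_iff tendsto_Pair by blast
qed

end
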